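(* Let $e:X\to Y$ be a compactification of a completely regular space $X$ and let $s:X\to\beta X$ be the Stone–Čech compactification of $X$. Then the following conditions are equivalent. (1) The de Vries extension $e^{-1}:\mathcal{RO}(Y)\to\wp(X)$ is maximal. (2) $e$ is isomorphic to $s$ in the category $\mathsf{Comp}$. (3) $e$ is equivalent to $s$.
   Context: **Compactifications.** Completely regular spaces are taken to be Hausdorff. A compactification of a completely regular space $X$ is a topological embedding $e:X\to Y$ with $Y$ compact Hausdorff and $e(X)$ dense in $Y$. For compactifications $e:X\to Y$, $e':X\to Y'$ of the same space, $e\le e'$ means there is a continuous $f:Y'\to Y$ with $f\circ e'=e$; $e$ and $e'$ are equivalent if $e\le e'$ and $e'\le e$ (equivalently, there is a homeomorphism $f:Y'\to Y$ with $f\circ e'=e$). The Stone–Čech compactification is the largest one up to equivalence. The category $\mathsf{Comp}$ has as objects compactifications $e:X\to Y$ ($X$ varying); a morphism from $e:X\to Y$ to $e':X'\to Y'$ is a pair $(f,g)$ of continuous maps $f:X\to X'$, $g:Y\to Y'$ with $g\circ e=e'\circ f$; composition is componentwise. **De Vries algebras.** A de Vries proximity on a Boolean algebra $A$ is a binary relation $\prec$ such that: (DV1) $1\prec 1$; (DV2) $a\prec b$ implies $a\le b$; (DV3) $a\le b\prec c\le d$ implies $a\prec d$; (DV4) $a\prec b$ and $a\prec c$ imply $a\prec b\wedge c$; (DV5) $a\prec b$ implies $\neg b\prec\neg a$; (DV6) $a\prec b$ implies there is $c$ with $a\prec c\prec b$; (DV7) $b\neq 0$ implies there is $a\neq 0$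 with $a\prec b$. A de Vries algebra is a pair $\mathfrak{A}=(A,\prec)$ with $A$ a complete Boolean algebra and $\prec$ a de Vries proximity on $A$. It is extremally disconnected if $\prec$ is $\le$, and atomic if $A$ is an atomic Boolean algebra. A map $\rho:\mathfrak{A}\to\mathfrak{B}$ between de Vries algebras is a de Vries morphism if (M1) $\rho(0)=0$; (M2) $\rho(a\wedge b)=\rho(a)\wedge\rho(b)$; (M3) $a\prec b$ implies $\neg\rho(\neg a)\prec\rho(b)$; (M4) $\rho(b)=\bigvee\{\rho(a)\mid a\prec b\}$. The composition of de Vries morphisms is $(\rho_2\star\rho_1)(b)=\bigvee\{\rho_2\rho_1(a)\mid a\prec b\}$. **De Vries extensions.** A de Vries extension is a one-to-one de Vries morphism $\alpha:\mathfrak{A}\to\mathfrak{B}$, with $\mathfrak{A}$ a de Vries algebra and $\mathfrak{B}=(B,\le)$ an atomic extremally disconnected de Vries algebra, such that each element of $\mathfrak{B}$ is a join of meets of elements of $\alpha[\mathfrak{A}]$. Two de Vries extensions $\alpha:\mathfrak{A}\to\mathfrak{B}$ and $\gamma:\mathfrak{C}\to\mathfrak{B}$ are compatible if $\alpha[\mathfrak{A}]=\gamma[\mathfrak{C}]$. A de Vries extension $\alpha:\mathfrak{A}\to\mathfrak{B}$ is maximal if for every compatible de Vries extension $\gamma:\mathfrak{C}\to\mathfrak{B}$ there is a de Vries morphism $\delta:\mathfrak{C}\to\mathfrak{A}$ with $\alpha\star\delta=\gamma$. **The extension of a compactification.** $\mathcal{RO}(Y)$ is the complete Boolean algebra of regular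 open subsets of $Y$ with proximity $U\prec V$ iff $\operatorname{cl}(U)\subseteq V$, and $\wp(X)$ denotes the atomic extremally disconnected de Vries algebra $(\wp(X),\subseteq)$. For every compactification $e:X\to Y$ the map $e^{-1}:\mathcal{RO}(Y)\to\wp(X)$ is a de Vries extension. *)

theory Defs
  imports "HOL-Analysis.Analysis" "HOL-Algebra.Complete_Lattice"
begin

(* otherwise closure_of is ambiguous *)
no_notation eq_closure_of (\<open>closure'_of\<index>\<close>)

section \<open>Compactifications\<close>

definition compactification :: "'x topology \<Rightarrow> 'y topology \<Rightarrow> ('x \<Rightarrow> 'y) \<Rightarrow> bool" where
  "compactification X Y e \<longleftrightarrow>
     completely_regular_space X \<and> Hausdorff_space X \<and>
     compact_space Y \<and> Hausdorff_space Y \<and>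
     embedding_map X Y e \<and> Y closure_of (e ` topspace X) = topspace Y"

definition compactification_le ::
    "'x topology \<Rightarrow> 'y topology \<Rightarrow> ('x \<Rightarrow> 'y) \<Rightarrow> 'z topology \<Rightarrow> ('x \<Rightarrow> 'z) \<Rightarrow> bool" where
  "compactification_le X Y e Y' e' \<longleftrightarrow>
     (\<exists>f. continuous_map Y' Y f \<and> (\<forall>x \<in> topspace X. f (e' x) = e x))"

definition compactification_equiv ::
    "'x topology \<Rightarrow> 'y topology \<Rightarrow> ('x \<Rightarrow> 'y) \<Rightarrow> 'z topology \<Rightarrow> ('x \<Rightarrow> 'z) \<Rightarrow> bool" where
  "compactification_equiv X Y e Y' e' \<longleftrightarrow>
     compactification_le X Y e Y' e' \<and> compactification_le X Y' e' Y e"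

text \<open>
  The largest compactification. A definition cannot quantify over types, so the compactifications
  compared with \<open>s\<close> are those whose points are sets of subsets of \<open>X\<close>. Every compactification
  of \<open>X\<close> is homeomorphic over \<open>X\<close> to one of these, so \<open>s\<close> is above all compactifications of \<open>X\<close>,
  in any type: see \<open>stone_cech_largest\<close> below.
\<close>

definition stone_cech :: "'x topology \<Rightarrow> 'z topology \<Rightarrow> ('x \<Rightarrow> 'z) \<Rightarrow> bool" where
  "stone_cech X Z s \<longleftrightarrow>
     compactification X Z s \<and>
     (\<forall>(Y :: 'x set set topology) e. compactification X Y e \<longrightarrow> compactification_le X Y e Z s)"

lemma embedding_map_image:
  assumes "embedding_map X Y e"
  shows "e ` topspace X \<subseteq> topspace Y"
proof -
  have "e ` topspace X = topspace (subtopology Y (e ` topspace X))"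
    using assms unfolding embedding_map_def by (rule homeomorphic_imp_surjective_map)
  then show ?thesis
    unfolding topspace_subtopology by blast
qed

lemma compactification_copy:
  fixes X :: "'x topology" and Y :: "'y topology"
  assumes "compactification X Y e"
  obtains Y' :: "'x set set topology" and h where
    "homeomorphic_map Y Y' h" "compactification X Y' (h \<circ> e)"
proof -
  define h where "h y = {{x \<in> topspace X. e x \<in> U} | U. openin Y U \<and> y \<in> U}" for y
  have dense: "Y closure_of (e ` topspace X) = topspace Y" and haus: "Hausdorff_space Y"
    and emb: "embedding_map X Y e"
    using assms by (auto simp: compactification_def)
  have inj: "inj_on h (topspace Y)"
  proof (rule inj_onI, rule ccontr)
    fix y z assume y: "y \<in> topspace Y" and z: "z \<in> topspace Y" and eq: "h y = h z" and "y \<noteq> z"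
    then obtain U V where UV: "openin Y U" "openin Y V" "y \<in> U" "z \<in> V" "disjnt U V"
      using haus unfolding Hausdorff_space_def by metis
    have "{x \<in> topspace X. e x \<in> U} \<in> h y"
      unfolding h_def using UV(1,3) by blast
    then have "{x \<in> topspace X. e x \<in> U} \<in> h z"
      by (simp only: eq)
    then obtain W where W: "openin Y W" "z \<in> W"
        "{x \<in> topspace X. e x \<in> U} = {x \<in> topspace X. e x \<in> W}"
      by (auto simp: h_def)
    have "openin Y (W \<inter> V)" "W \<inter> V \<noteq> {}" using W UV by auto
    then have "e ` topspace X \<inter> (W \<inter> V) \<noteq> {}"
      using dense dense_intersects_open by metis
    then obtain x where "x \<in> topspace X" "e x \<in> W \<inter> V" by auto
    with W UV show False unfolding disjnt_def by blast
  qed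
  define k where "k = inv_into (topspace Y) h"
  define Y' where "Y' = pullback_topology (h ` topspace Y) k Y"
  have kh: "k (h y) = y" if "y \<in> topspace Y" for y
    using that inj by (simp add: k_def)
  have hom: "homeomorphic_maps Y Y' h k"
    unfolding homeomorphic_maps_def
  proof (intro conjI ballI)
    have "continuous_map Y Y (k \<circ> h)"
      by (rule continuous_map_eq[OF continuous_map_id]) (auto simp: kh)
    then show "continuous_map Y Y' h"
      unfolding Y'_def by (intro continuous_map_pullback') auto
    show "continuous_map Y' Y k"
      using continuous_map_pullback[OF continuous_map_id, of "h ` topspace Y" k Y]
      by (simp add: Y'_def)
  qed (auto simp: kh Y'_def topspace_pullback_topology)
  then have h: "homeomorphic_map Y Y' h"
    by (auto simp: homeomorphic_map_maps)
  have sp: "Y homeomorphic_space Y'"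
    using hom by (auto simp: homeomorphic_space_def)
  have sub: "e ` topspace X \<subseteq> topspace Y"
    by (rule embedding_map_image[OF emb])
  have "embedding_map X Y' (h \<circ> e)"
    by (rule embedding_map_compose[OF emb])
      (simp add: h homeomorphic_imp_surjective_map[OF h] embedding_map_def)
  moreover have "Y' closure_of ((h \<circ> e) ` topspace X) = topspace Y'"
    using homeomorphic_map_closure_of[OF h sub] homeomorphic_imp_surjective_map[OF h] dense
    by (simp add: image_comp)
  ultimately have "compactification X Y' (h \<circ> e)"
    using assms homeomorphic_compact_space[OF sp] homeomorphic_Hausdorff_space[OF sp]
    by (auto simp: compactification_def)
  with h that show thesis by blast
qed

lemma stone_cech_largest:
  fixes X :: "'x topology" and Y :: "'y topology" and Z :: "'z topology"
  assumes s: "stone_cech X Z s" and e: "compactification X Y e"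
  shows "compactification_le X Y e Z s"
proof -
  obtain Y' :: "'x set set topology" and h where
    h: "homeomorphic_map Y Y' h" and Y': "compactification X Y' (h \<circ> e)"
    using compactification_copy[OF e] by blast
  obtain k where k: "homeomorphic_maps Y Y' h k"
    using h homeomorphic_map_maps by blast
  obtain f where f: "continuous_map Z Y' f" "\<And>x. x \<in> topspace X \<Longrightarrow> f (s x) = h (e x)"
    using s Y' unfolding stone_cech_def compactification_le_def comp_apply by blast
  have "e ` topspace X \<subseteq> topspace Y"
    using e by (simp add: compactification_def embedding_map_image)
  then have "\<forall>x \<in> topspace X. (k \<circ> f) (s x) = e x"
    using f k by (auto simp: homeomorphic_maps_def)
  moreover have "continuous_map Z Y (k \<circ> f)"
    using f k continuous_map_compose by (auto simp: homeomorphic_maps_def)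
  ultimately show ?thesis
    unfolding compactification_le_def by blast
qed

subsection \<open>The category of compactifications\<close>

definition comp_morphism ::
    "'x topology \<Rightarrow> 'y topology \<Rightarrow> ('x \<Rightarrow> 'y) \<Rightarrow> 'u topology \<Rightarrow> 'v topology \<Rightarrow> ('u \<Rightarrow> 'v) \<Rightarrow>
     ('x \<Rightarrow> 'u) \<times> ('y \<Rightarrow> 'v) \<Rightarrow> bool" where
  "comp_morphism X Y e X' Y' e' = (\<lambda>(f, g).
     continuous_map X X' f \<and> continuous_map Y Y' g \<and> (\<forall>x \<in> topspace X. g (e x) = e' (f x)))"

definition comp_compose ::
    "('u \<Rightarrow> 'p) \<times> ('v \<Rightarrow> 'q) \<Rightarrow> ('x \<Rightarrow> 'u) \<times> ('y \<Rightarrow> 'v) \<Rightarrow> ('x \<Rightarrow> 'p) \<times> ('y \<Rightarrow> 'q)" where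
  "comp_compose = (\<lambda>(f', g') (f, g). (f' \<circ> f, g' \<circ> g))"

text \<open>Maps between spaces are total functions, so morphisms are compared on the points only.\<close>

definition comp_is_identity ::
    "'x topology \<Rightarrow> 'y topology \<Rightarrow> ('x \<Rightarrow> 'x) \<times> ('y \<Rightarrow> 'y) \<Rightarrow> bool" where
  "comp_is_identity X Y = (\<lambda>(f, g). (\<forall>x \<in> topspace X. f x = x) \<and> (\<forall>y \<in> topspace Y. g y = y))"

definition comp_isomorphic ::
    "'x topology \<Rightarrow> 'y topology \<Rightarrow> ('x \<Rightarrow> 'y) \<Rightarrow> 'u topology \<Rightarrow> 'v topology \<Rightarrow> ('u \<Rightarrow> 'v) \<Rightarrow> bool"
where
  "comp_isomorphic X Y e X' Y' e' \<longleftrightarrow>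
     (\<exists>m n. comp_morphism X Y e X' Y' e' m \<and> comp_morphism X' Y' e' X Y e n \<and>
        comp_is_identity X Y (comp_compose n m) \<and> comp_is_identity X' Y' (comp_compose m n))"


section \<open>De Vries algebras\<close>

locale complete_boolean_lattice = complete_lattice L for L (structure) +
  assumes meet_join_distrib:
    "\<lbrakk>a \<in> carrier L; b \<in> carrier L; c \<in> carrier L\<rbrakk> \<Longrightarrow> a \<sqinter> (b \<squnion> c) = (a \<sqinter> b) \<squnion> (a \<sqinter> c)"
    and complement_exists:
    "a \<in> carrier L \<Longrightarrow> \<exists>b \<in> carrier L. a \<sqinter> b = \<bottom> \<and> a \<squnion> b = \<top>"

definition complement :: "('a, 'm) gorder_scheme \<Rightarrow> 'a \<Rightarrow> 'a" (\<open>\<sim>\<index> _\<close> [81] 80) where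
  "\<sim>\<^bsub>L\<^esub> a = (THE b. b \<in> carrier L \<and> a \<sqinter>\<^bsub>L\<^esub> b = \<bottom>\<^bsub>L\<^esub> \<and> a \<squnion>\<^bsub>L\<^esub> b = \<top>\<^bsub>L\<^esub>)"

record 'a proximity_order = "'a gorder" +
  prox :: "'a \<Rightarrow> 'a \<Rightarrow> bool"  (infixl \<open>\<lless>\<index>\<close> 50)

locale de_vries_algebra = complete_boolean_lattice A for A (structure) +
  assumes DV1: "\<top> \<lless> \<top>"
    and DV2: "\<lbrakk>a \<in> carrier A; b \<in> carrier A; a \<lless> b\<rbrakk> \<Longrightarrow> a \<sqsubseteq> b"
    and DV3: "\<lbrakk>a \<in> carrier A; b \<in> carrier A; c \<in> carrier A; d \<in> carrier A;
               a \<sqsubseteq> b; b \<lless> c; c \<sqsubseteq> d\<rbrakk> \<Longrightarrow> a \<lless> d"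
    and DV4: "\<lbrakk>a \<in> carrier A; b \<in> carrier A; c \<in> carrier A; a \<lless> b; a \<lless> c\<rbrakk> \<Longrightarrow> a \<lless> b \<sqinter> c"
    and DV5: "\<lbrakk>a \<in> carrier A; b \<in> carrier A; a \<lless> b\<rbrakk> \<Longrightarrow> \<sim> b \<lless> \<sim> a"
    and DV6: "\<lbrakk>a \<in> carrier A; b \<in> carrier A; a \<lless> b\<rbrakk> \<Longrightarrow> \<exists>c \<in> carrier A. a \<lless> c \<and> c \<lless> b"
    and DV7: "\<lbrakk>b \<in> carrier A; b \<noteq> \<bottom>\<rbrakk> \<Longrightarrow> \<exists>a \<in> carrier A. a \<noteq> \<bottom> \<and> a \<lless> b"

definition extremally_disconnected :: "'a proximity_order \<Rightarrow> bool" where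
  "extremally_disconnected A \<longleftrightarrow>
     (\<forall>a \<in> carrier A. \<forall>b \<in> carrier A. a \<lless>\<^bsub>A\<^esub> b \<longleftrightarrow> a \<sqsubseteq>\<^bsub>A\<^esub> b)"

definition lattice_atom :: "('a, 'm) gorder_scheme \<Rightarrow> 'a \<Rightarrow> bool" where
  "lattice_atom L a \<longleftrightarrow> a \<in> carrier L \<and> a \<noteq> \<bottom>\<^bsub>L\<^esub> \<and>
     (\<forall>b \<in> carrier L. b \<sqsubseteq>\<^bsub>L\<^esub> a \<longrightarrow> b = \<bottom>\<^bsub>L\<^esub> \<or> b = a)"

definition atomic :: "('a, 'm) gorder_scheme \<Rightarrow> bool" where
  "atomic L \<longleftrightarrow> (\<forall>b \<in> carrier L. b \<noteq> \<bottom>\<^bsub>L\<^esub> \<longrightarrow> (\<exists>a. lattice_atom L a \<and> a \<sqsubseteq>\<^bsub>L\<^esub> b))"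

locale de_vries_morphism =
  source: de_vries_algebra A + target: de_vries_algebra B
  for A :: "'a proximity_order" and B :: "'b proximity_order" and \<rho> :: "'a \<Rightarrow> 'b" +
  assumes closed: "\<rho> \<in> carrier A \<rightarrow> carrier B"
    and M1: "\<rho> \<bottom>\<^bsub>A\<^esub> = \<bottom>\<^bsub>B\<^esub>"
    and M2: "\<lbrakk>a \<in> carrier A; b \<in> carrier A\<rbrakk> \<Longrightarrow> \<rho> (a \<sqinter>\<^bsub>A\<^esub> b) = \<rho> a \<sqinter>\<^bsub>B\<^esub> \<rho> b"
    and M3: "\<lbrakk>a \<in> carrier A; b \<in> carrier A; a \<lless>\<^bsub>A\<^esub> b\<rbrakk> \<Longrightarrow> \<sim>\<^bsub>B\<^esub> (\<rho> (\<sim>\<^bsub>A\<^esub> a)) \<lless>\<^bsub>B\<^esub> \<rho> b"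
    and M4: "b \<in> carrier A \<Longrightarrow> \<rho> b = \<Squnion>\<^bsub>B\<^esub> {\<rho> a | a. a \<in> carrier A \<and> a \<lless>\<^bsub>A\<^esub> b}"

text \<open>\<open>A\<close> is the source of \<open>\<rho>1\<close> and \<open>C\<close> is the target of \<open>\<rho>2\<close>.\<close>

definition dv_compose ::
    "'a proximity_order \<Rightarrow> 'c proximity_order \<Rightarrow> ('b \<Rightarrow> 'c) \<Rightarrow> ('a \<Rightarrow> 'b) \<Rightarrow> 'a \<Rightarrow> 'c" where
  "dv_compose A C \<rho>2 \<rho>1 b = \<Squnion>\<^bsub>C\<^esub> {\<rho>2 (\<rho>1 a) | a. a \<in> carrier A \<and> a \<lless>\<^bsub>A\<^esub> b}"

subsection \<open>De Vries extensions\<close>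

locale de_vries_extension = de_vries_morphism A B \<alpha>
  for A :: "'a proximity_order" and B :: "'b proximity_order" and \<alpha> :: "'a \<Rightarrow> 'b" +
  assumes inj: "inj_on \<alpha> (carrier A)"
    and target_extremally_disconnected: "extremally_disconnected B"
    and target_atomic: "atomic B"
    and join_of_meets: "b \<in> carrier B \<Longrightarrow>
      \<exists>\<T>. (\<forall>T \<in> \<T>. T \<subseteq> \<alpha> ` carrier A) \<and> b = \<Squnion>\<^bsub>B\<^esub> {\<Sqinter>\<^bsub>B\<^esub> T | T. T \<in> \<T>}"

definition compatible ::
    "'a proximity_order \<Rightarrow> ('a \<Rightarrow> 'b) \<Rightarrow> 'c proximity_order \<Rightarrow> ('c \<Rightarrow> 'b) \<Rightarrow> bool" where
  "compatible A \<alpha> C \<gamma> \<longleftrightarrow> \<alpha> ` carrier A = \<gamma> ` carrier C"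

text \<open>
  In a compatible extension \<open>\<gamma>\<close> of \<open>C\<close>, the map \<open>\<gamma>\<close> is a bijection from \<open>C\<close> onto the image of \<open>A\<close>,
  so \<open>C\<close> is isomorphic to a de Vries algebra on the carrier of \<open>A\<close>. Hence it is enough to let \<open>C\<close>
  range over the de Vries algebras in the type of \<open>A\<close>; the property then holds for \<open>C\<close> in any
  type: see \<open>maximal_extension_universal\<close> below.
\<close>

definition maximal_extension ::
    "'a proximity_order \<Rightarrow> 'b proximity_order \<Rightarrow> ('a \<Rightarrow> 'b) \<Rightarrow> bool" where
  "maximal_extension A B \<alpha> \<longleftrightarrow> de_vries_extension A B \<alpha> \<and>
     (\<forall>(C :: 'a proximity_order) \<gamma>. de_vries_extension C B \<gamma> \<and> compatible A \<alpha> C \<gamma> \<longrightarrow>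
        (\<exists>\<delta>. de_vries_morphism C A \<delta> \<and> (\<forall>c \<in> carrier C. dv_compose C B \<alpha> \<delta> c = \<gamma> c)))"

context complete_boolean_lattice
begin

lemma complement_unique:
  assumes "a \<in> carrier L" "b \<in> carrier L" "c \<in> carrier L"
    "a \<sqinter> b = \<bottom>" "a \<squnion> b = \<top>" "a \<sqinter> c = \<bottom>"
  shows "c \<sqsubseteq> b"
proof -
  have "c = c \<sqinter> (a \<squnion> b)"
    using assms top_higher[of c] le_iff_join[of c "\<top>"] by simp
  also have "\<dots> = (c \<sqinter> a) \<squnion> (c \<sqinter> b)"
    using assms by (intro meet_join_distrib)
  also have "\<dots> = c \<sqinter> b"
    using assms meet_comm[of L c a] le_iff_meet[of "\<bottom>" "c \<sqinter> b"] by simp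
  finally show ?thesis
    using assms meet_right[of c b] by simp
qed

lemma complement:
  assumes "a \<in> carrier L"
  shows "\<sim> a \<in> carrier L" "a \<sqinter> \<sim> a = \<bottom>" "a \<squnion> \<sim> a = \<top>"
proof -
  have "\<exists>!b. b \<in> carrier L \<and> a \<sqinter> b = \<bottom> \<and> a \<squnion> b = \<top>"
    using complement_exists[OF assms] complement_unique[OF assms] le_antisym by metis
  from theI'[OF this] show "\<sim> a \<in> carrier L" "a \<sqinter> \<sim> a = \<bottom>" "a \<squnion> \<sim> a = \<top>"
    unfolding complement_def by auto
qed

lemma le_complement:
  assumes "a \<in> carrier L" "c \<in> carrier L" "a \<sqinter> c = \<bottom>"
  shows "c \<sqsubseteq> \<sim> a"
  using complement_unique complement assms by metis

end

lemma (in de_vries_extension) le_iff: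
  assumes "a \<in> carrier A" "b \<in> carrier A"
  shows "\<alpha> a \<sqsubseteq>\<^bsub>B\<^esub> \<alpha> b \<longleftrightarrow> a \<sqsubseteq>\<^bsub>A\<^esub> b"
proof -
  have cl: "\<alpha> a \<in> carrier B" "\<alpha> b \<in> carrier B" using assms closed by auto
  have "\<alpha> a \<sqsubseteq>\<^bsub>B\<^esub> \<alpha> b \<longleftrightarrow> \<alpha> a \<sqinter>\<^bsub>B\<^esub> \<alpha> b = \<alpha> a"
    using cl target.le_iff_join[of "\<alpha> a" "\<alpha> b"] by auto
  also have "\<dots> \<longleftrightarrow> \<alpha> (a \<sqinter>\<^bsub>A\<^esub> b) = \<alpha> a"
    using M2 assms by simp
  also have "\<dots> \<longleftrightarrow> a \<sqinter>\<^bsub>A\<^esub> b = a"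
    using inj assms by (auto dest: inj_onD)
  also have "\<dots> \<longleftrightarrow> a \<sqsubseteq>\<^bsub>A\<^esub> b"
    using assms source.le_iff_join[of a b] by auto
  finally show ?thesis .
qed

lemma maximal_extension_universal:
  fixes A :: "'a proximity_order" and B :: "'b proximity_order" and C :: "'c proximity_order"
  assumes max: "maximal_extension A B \<alpha>"
    and \<gamma>: "de_vries_extension C B \<gamma>" and comp: "compatible A \<alpha> C \<gamma>"
  shows "\<exists>\<delta>. de_vries_morphism C A \<delta> \<and> (\<forall>c \<in> carrier C. dv_compose C B \<alpha> \<delta> c = \<gamma> c)"
proof -
  interpret A: de_vries_extension A B \<alpha> using max by (simp add: maximal_extension_def)
  interpret C: de_vries_extension C B \<gamma> by (rule \<gamma>)
  have img: "\<alpha> ` carrier A = \<gamma> ` carrier C" using comp by (simp add: compatible_def)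
  define h where "h c = inv_into (carrier A) \<alpha> (\<gamma> c)" for c
  define k where "k a = inv_into (carrier C) \<gamma> (\<alpha> a)" for a
  have h: "h c \<in> carrier A" "\<alpha> (h c) = \<gamma> c" if "c \<in> carrier C" for c
    using that img by (auto simp: h_def inv_into_into f_inv_into_f)
  have k: "k a \<in> carrier C" "\<gamma> (k a) = \<alpha> a" if "a \<in> carrier A" for a
    using that img by (auto simp: k_def inv_into_into f_inv_into_f simp flip: img)
  have injA: "a = b" if "\<alpha> a = \<alpha> b" "a \<in> carrier A" "b \<in> carrier A" for a b
    using that A.inj by (auto dest: inj_onD)
  have injC: "a = b" if "\<gamma> a = \<gamma> b" "a \<in> carrier C" "b \<in> carrier C" for a b
    using that C.inj by (auto dest: inj_onD)
  have kh: "k (h c) = c" if "c \<in> carrier C" for c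
    using that by (intro injC) (simp_all add: h k)
  have hk: "h (k a) = a" if "a \<in> carrier A" for a
    using that by (intro injA) (simp_all add: h k)
  have k_le: "k a \<sqsubseteq>\<^bsub>C\<^esub> k b \<longleftrightarrow> a \<sqsubseteq>\<^bsub>A\<^esub> b" if "a \<in> carrier A" "b \<in> carrier A" for a b
    using that A.le_iff[of a b] C.le_iff[of "k a" "k b"] by (simp add: k)
  have k_bot: "k \<bottom>\<^bsub>A\<^esub> = \<bottom>\<^bsub>C\<^esub>"
    by (intro injC) (simp_all add: k A.M1 C.M1)
  have k_meet: "k (a \<sqinter>\<^bsub>A\<^esub> b) = k a \<sqinter>\<^bsub>C\<^esub> k b" if "a \<in> carrier A" "b \<in> carrier A" for a b
    using that by (intro injC) (simp_all add: k A.M2 C.M2)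
  have h_bot: "h \<bottom>\<^bsub>C\<^esub> = \<bottom>\<^bsub>A\<^esub>"
    by (intro injA) (simp_all add: h A.M1 C.M1)
  have h_meet: "h (a \<sqinter>\<^bsub>C\<^esub> b) = h a \<sqinter>\<^bsub>A\<^esub> h b" if "a \<in> carrier C" "b \<in> carrier C" for a b
    using that by (intro injA) (simp_all add: h A.M2 C.M2)
  have k_top: "k \<top>\<^bsub>A\<^esub> = \<top>\<^bsub>C\<^esub>"
  proof -
    have "h \<top>\<^bsub>C\<^esub> \<sqsubseteq>\<^bsub>A\<^esub> \<top>\<^bsub>A\<^esub>" by (simp add: h)
    then have "\<top>\<^bsub>C\<^esub> \<sqsubseteq>\<^bsub>C\<^esub> k \<top>\<^bsub>A\<^esub>"
      using k_le[of "h \<top>\<^bsub>C\<^esub>" "\<top>\<^bsub>A\<^esub>"] by (simp add: h kh)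
    then show ?thesis by (intro C.source.le_antisym) (simp_all add: k)
  qed
  have k_compl: "k (\<sim>\<^bsub>A\<^esub> a) = \<sim>\<^bsub>C\<^esub> (k a)" if a: "a \<in> carrier A" for a
  proof (rule C.source.le_antisym)
    have "k a \<sqinter>\<^bsub>C\<^esub> k (\<sim>\<^bsub>A\<^esub> a) = \<bottom>\<^bsub>C\<^esub>"
      using a by (simp add: A.source.complement k_bot flip: k_meet)
    then show "k (\<sim>\<^bsub>A\<^esub> a) \<sqsubseteq>\<^bsub>C\<^esub> \<sim>\<^bsub>C\<^esub> (k a)"
      using a by (intro C.source.le_complement) (simp_all add: k A.source.complement)
    have "h (k a) \<sqinter>\<^bsub>A\<^esub> h (\<sim>\<^bsub>C\<^esub> (k a)) = \<bottom>\<^bsub>A\<^esub>"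
      using a by (simp add: k C.source.complement h_bot flip: h_meet)
    then have "h (\<sim>\<^bsub>C\<^esub> (k a)) \<sqsubseteq>\<^bsub>A\<^esub> \<sim>\<^bsub>A\<^esub> a"
      using a by (intro A.source.le_complement) (simp_all add: h k hk C.source.complement)
    then show "\<sim>\<^bsub>C\<^esub> (k a) \<sqsubseteq>\<^bsub>C\<^esub> k (\<sim>\<^bsub>A\<^esub> a)"
      using a k_le[of "h (\<sim>\<^bsub>C\<^esub> (k a))" "\<sim>\<^bsub>A\<^esub> a"]
      by (simp add: h k kh A.source.complement C.source.complement)
  qed (use a in \<open>simp_all add: k A.source.complement C.source.complement\<close>)
  have h_compl: "h (\<sim>\<^bsub>C\<^esub> c) = \<sim>\<^bsub>A\<^esub> (h c)" if "c \<in> carrier C" for c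
    using k_compl[of "h c"] that hk[of "\<sim>\<^bsub>A\<^esub> (h c)"]
    by (simp add: h kh A.source.complement)

  define C' where "C' = A\<lparr>prox := \<lambda>a b. k a \<lless>\<^bsub>C\<^esub> k b\<rparr>"
  have C'_simps: "carrier C' = carrier A" "gorder.le C' = gorder.le A" "eq C' = eq A"
    "a \<lless>\<^bsub>C'\<^esub> b \<longleftrightarrow> k a \<lless>\<^bsub>C\<^esub> k b" for a b
    by (simp_all add: C'_def)
  have Upper: "Upper C' = Upper A" and Lower: "Lower C' = Lower A"
    by (intro ext, simp add: Upper_def Lower_def C'_simps)+
  have least: "least C' = least A" and greatest: "greatest C' = greatest A"
    by (intro ext, simp add: least_def greatest_def C'_simps)+
  have ops: "Lattice.sup C' = Lattice.sup A" "Lattice.inf C' = Lattice.inf A"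
    "\<bottom>\<^bsub>C'\<^esub> = \<bottom>\<^bsub>A\<^esub>" "\<top>\<^bsub>C'\<^esub> = \<top>\<^bsub>A\<^esub>"
    by (simp_all add: Lattice.sup_def Lattice.inf_def fun_eq_iff bottom_def top_def
        Upper Lower least greatest C'_simps)
  have ops2: "join C' = join A" "meet C' = meet A"
    by (simp_all add: fun_eq_iff join_def meet_def ops)
  have compl: "complement C' = complement A"
    by (simp add: fun_eq_iff complement_def ops ops2 C'_simps)
  note C' = C'_simps ops ops2 compl Upper Lower least greatest
  have "partial_order C'"
    by unfold_locales
      (auto simp: C' A.source.eq_is_equal intro: A.source.le_trans A.source.le_antisym)
  then interpret C': partial_order C' .
  have dv: "de_vries_algebra C'"
  proof unfold_locales
    fix b assume b: "b \<in> carrier C'" "b \<noteq> \<bottom>\<^bsub>C'\<^esub>"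
    then have "k b \<in> carrier C" "k b \<noteq> \<bottom>\<^bsub>C\<^esub>"
      using hk[of b] h_bot by (auto simp: C' k)
    then obtain c where "c \<in> carrier C" "c \<noteq> \<bottom>\<^bsub>C\<^esub>" "c \<lless>\<^bsub>C\<^esub> k b"
      using C.source.DV7 by blast
    then show "\<exists>a\<in>carrier C'. a \<noteq> \<bottom>\<^bsub>C'\<^esub> \<and> a \<lless>\<^bsub>C'\<^esub> b"
      using k_bot kh[of c] by (intro bexI[of _ "h c"]) (metis C'_simps(4) ops(3), simp add: C' h)
  next
    fix a b assume "a \<in> carrier C'" "b \<in> carrier C'" "a \<lless>\<^bsub>C'\<^esub> b"
    then obtain c where "c \<in> carrier C" "k a \<lless>\<^bsub>C\<^esub> c" "c \<lless>\<^bsub>C\<^esub> k b"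
      using C.source.DV6[of "k a" "k b"] by (auto simp: C' k)
    then show "\<exists>c\<in>carrier C'. a \<lless>\<^bsub>C'\<^esub> c \<and> c \<lless>\<^bsub>C'\<^esub> b"
      by (intro bexI[of _ "h c"]) (auto simp: C' h kh)
  next
    show "\<top>\<^bsub>C'\<^esub> \<lless>\<^bsub>C'\<^esub> \<top>\<^bsub>C'\<^esub>" by (simp add: C' k_top C.source.DV1)
  next
    fix a b assume "a \<in> carrier C'" "b \<in> carrier C'" "a \<lless>\<^bsub>C'\<^esub> b"
    then show "a \<sqsubseteq>\<^bsub>C'\<^esub> b" using C.source.DV2[of "k a" "k b"] by (simp add: C' k k_le)
  next
    fix a b c d assume "a \<in> carrier C'" "b \<in> carrier C'" "c \<in> carrier C'" "d \<in> carrier C'"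
      "a \<sqsubseteq>\<^bsub>C'\<^esub> b" "b \<lless>\<^bsub>C'\<^esub> c" "c \<sqsubseteq>\<^bsub>C'\<^esub> d"
    then show "a \<lless>\<^bsub>C'\<^esub> d"
      using C.source.DV3[of "k a" "k b" "k c" "k d"] by (simp add: C' k k_le)
  next
    fix a b c assume "a \<in> carrier C'" "b \<in> carrier C'" "c \<in> carrier C'"
      "a \<lless>\<^bsub>C'\<^esub> b" "a \<lless>\<^bsub>C'\<^esub> c"
    then show "a \<lless>\<^bsub>C'\<^esub> b \<sqinter>\<^bsub>C'\<^esub> c"
      using C.source.DV4[of "k a" "k b" "k c"] by (simp add: C' k k_meet)
  next
    fix a b assume "a \<in> carrier C'" "b \<in> carrier C'" "a \<lless>\<^bsub>C'\<^esub> b"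
    then show "\<sim>\<^bsub>C'\<^esub> b \<lless>\<^bsub>C'\<^esub> \<sim>\<^bsub>C'\<^esub> a"
      using C.source.DV5[of "k a" "k b"] by (simp add: C' k k_compl)
  qed (simp_all add: C' A.source.sup_exists A.source.inf_exists A.source.meet_join_distrib
      A.source.complement_exists)
  then interpret C': de_vries_algebra C' .
  have k_image: "{f c | c. c \<in> carrier C \<and> c \<lless>\<^bsub>C\<^esub> d} =
      {f (k a) | a. a \<in> carrier C' \<and> a \<lless>\<^bsub>C'\<^esub> b}" if "b \<in> carrier A" "d = k b" for f :: "'c \<Rightarrow> 't" and b d
  proof -
    have "\<exists>a. f c = f (k a) \<and> a \<in> carrier A \<and> k a \<lless>\<^bsub>C\<^esub> d"
      if "c \<in> carrier C" "c \<lless>\<^bsub>C\<^esub> d" for c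
      using that by (intro exI[of _ "h c"]) (simp add: h kh)
    with that show ?thesis by (auto simp: C' k)
  qed
  have "de_vries_extension C' B \<alpha>"
  proof unfold_locales
    fix a b assume "a \<in> carrier C'" "b \<in> carrier C'" "a \<lless>\<^bsub>C'\<^esub> b"
    then show "\<sim>\<^bsub>B\<^esub> \<alpha> (\<sim>\<^bsub>C'\<^esub> a) \<lless>\<^bsub>B\<^esub> \<alpha> b"
      using C.M3[of "k a" "k b"]
      by (simp add: C' k A.source.complement flip: k_compl)
  next
    fix b assume "b \<in> carrier C'"
    then have b: "b \<in> carrier A" by (simp add: C')
    have "{\<gamma> (k a) | a. a \<in> carrier C' \<and> a \<lless>\<^bsub>C'\<^esub> b} = {\<alpha> a | a. a \<in> carrier C' \<and> a \<lless>\<^bsub>C'\<^esub> b}"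
      by (metis (no_types, lifting) C'_simps(1) k(2))
    with C.M4[OF k(1)[OF b]] show "\<alpha> b = \<Squnion>\<^bsub>B\<^esub>{\<alpha> a | a. a \<in> carrier C' \<and> a \<lless>\<^bsub>C'\<^esub> b}"
      using k_image[OF b refl, of \<gamma>] b by (simp add: k)
  qed (use A.closed A.inj A.target_extremally_disconnected A.target_atomic A.join_of_meets
      in \<open>auto simp: C' A.M1 A.M2\<close>)
  moreover have "compatible A \<alpha> C' \<alpha>"
    by (simp add: compatible_def C')
  ultimately obtain \<delta> where \<delta>: "de_vries_morphism C' A \<delta>"
      "\<And>a. a \<in> carrier C' \<Longrightarrow> dv_compose C' B \<alpha> \<delta> a = \<alpha> a"
    using max unfolding maximal_extension_def by blast
  interpret \<delta>: de_vries_morphism C' A \<delta> by (rule \<delta>)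
  have \<delta>h: "{f (\<delta> (h c)) | c. c \<in> carrier C \<and> c \<lless>\<^bsub>C\<^esub> d} =
      {f (\<delta> a) | a. a \<in> carrier C' \<and> a \<lless>\<^bsub>C'\<^esub> h d}" if "d \<in> carrier C" for f :: "'a \<Rightarrow> 't" and d
  proof -
    have "{f (\<delta> (h c)) | c. c \<in> carrier C \<and> c \<lless>\<^bsub>C\<^esub> d} =
        {f (\<delta> (h (k a))) | a. a \<in> carrier C' \<and> a \<lless>\<^bsub>C'\<^esub> h d}"
      using k_image[of "h d" d "\<lambda>c. f (\<delta> (h c))"] that by (simp add: h kh)
    also have "\<dots> = {f (\<delta> a) | a. a \<in> carrier C' \<and> a \<lless>\<^bsub>C'\<^esub> h d}"
      by (metis (no_types, lifting) C'_simps(1) hk)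
    finally show ?thesis .
  qed
  have "de_vries_morphism C A (\<delta> \<circ> h)"
  proof unfold_locales
    show "\<delta> \<circ> h \<in> carrier C \<rightarrow> carrier A" using \<delta>.closed by (auto simp: C' h)
    show "(\<delta> \<circ> h) \<bottom>\<^bsub>C\<^esub> = \<bottom>\<^bsub>A\<^esub>" using \<delta>.M1 by (simp add: C' h_bot)
  next
    fix a b assume "a \<in> carrier C" "b \<in> carrier C"
    then show "(\<delta> \<circ> h) (a \<sqinter>\<^bsub>C\<^esub> b) = (\<delta> \<circ> h) a \<sqinter>\<^bsub>A\<^esub> (\<delta> \<circ> h) b"
      using \<delta>.M2[of "h a" "h b"] by (simp add: C' h h_meet)
  next
    fix a b assume "a \<in> carrier C" "b \<in> carrier C" "a \<lless>\<^bsub>C\<^esub> b"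
    then show "\<sim>\<^bsub>A\<^esub> (\<delta> \<circ> h) (\<sim>\<^bsub>C\<^esub> a) \<lless>\<^bsub>A\<^esub> (\<delta> \<circ> h) b"
      using \<delta>.M3[of "h a" "h b"] by (simp add: C' h kh h_compl)
  next
    fix b assume "b \<in> carrier C"
    then show "(\<delta> \<circ> h) b = \<Squnion>\<^bsub>A\<^esub>{(\<delta> \<circ> h) a | a. a \<in> carrier C \<and> a \<lless>\<^bsub>C\<^esub> b}"
      using \<delta>.M4[of "h b"] \<delta>h[of b "\<lambda>x. x"] by (simp add: C'_simps(1) h)
  qed
  moreover have "dv_compose C B \<alpha> (\<delta> \<circ> h) c = \<gamma> c" if "c \<in> carrier C" for c
    using \<delta>(2)[of "h c"] \<delta>h[OF that, of \<alpha>] that by (simp add: dv_compose_def C'_simps(1) h)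
  ultimately show ?thesis by blast
qed

subsection \<open>The extension of a compactification\<close>

text \<open>
  The Boolean structure of both algebras is the one determined by inclusion. For regular open sets,
  binary meet is intersection, the join of a family is the interior of the closure of its union,
  and the complement of \<open>U\<close> is the interior of its set complement.
\<close>

definition regular_openin :: "'y topology \<Rightarrow> 'y set \<Rightarrow> bool" where
  "regular_openin Y U \<longleftrightarrow> Y interior_of (Y closure_of U) = U"

definition regular_open_algebra :: "'y topology \<Rightarrow> 'y set proximity_order" where
  "regular_open_algebra Y =
     \<lparr>carrier = {U. regular_openin Y U}, eq = (=), le = (\<subseteq>),
      prox = (\<lambda>U V. Y closure_of U \<subseteq> V)\<rparr>"

definition powerset_algebra :: "'x topology \<Rightarrow> 'x set proximity_order" where
  "powerset_algebra X =
     \<lparr>carrier = Pow (topspace X), eq = (=), le = (\<subseteq>), prox = (\<subseteq>)\<rparr>"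

definition preimage_map :: "'x topology \<Rightarrow> ('x \<Rightarrow> 'y) \<Rightarrow> 'y set \<Rightarrow> 'x set" where
  "preimage_map X e U = {x \<in> topspace X. e x \<in> U}"

lemma (in partial_order) sup_eqI: "least L s (Upper L A) \<Longrightarrow> \<Squnion>A = s"
  unfolding sup_def by (rule some_equality) (auto intro: least_unique)

lemma (in partial_order) inf_eqI: "greatest L s (Lower L A) \<Longrightarrow> \<Sqinter>A = s"
  unfolding inf_def by (rule some_equality) (auto intro: greatest_unique)

lemma (in complete_boolean_lattice) complement_eqI:
  assumes "a \<in> carrier L" "b \<in> carrier L" "a \<sqinter> b = \<bottom>" "a \<squnion> b = \<top>"
  shows "\<sim> a = b"
proof (rule le_antisym)
  note c = complement[OF assms(1)]
  show "\<sim> a \<sqsubseteq> b" using complement_unique[OF assms(1,2) c(1) assms(3,4) c(2)] .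
  show "b \<sqsubseteq> \<sim> a" using le_complement[OF assms(1-3)] .
qed (use assms complement in auto)

lemma powerset_algebra_simps [simp]:
  "carrier (powerset_algebra X) = Pow (topspace X)"
  "eq (powerset_algebra X) = (=)"
  "a \<sqsubseteq>\<^bsub>powerset_algebra X\<^esub> b \<longleftrightarrow> a \<subseteq> b"
  "a \<lless>\<^bsub>powerset_algebra X\<^esub> b \<longleftrightarrow> a \<subseteq> b"
  by (simp_all add: powerset_algebra_def)

lemma partial_order_powerset: "partial_order (powerset_algebra X)"
  by unfold_locales auto

lemma powerset_least:
  "S \<subseteq> Pow (topspace X) \<Longrightarrow> least (powerset_algebra X) (\<Union>S) (Upper (powerset_algebra X) S)"
  by (fastforce simp: least_def Upper_def)

lemma powerset_greatest:
  "S \<subseteq> Pow (topspace X) \<Longrightarrow>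
   greatest (powerset_algebra X) (topspace X \<inter> \<Inter>S) (Lower (powerset_algebra X) S)"
  by (fastforce simp: greatest_def Lower_def)

lemma powerset_ops:
  shows powerset_sup: "S \<subseteq> Pow (topspace X) \<Longrightarrow> \<Squnion>\<^bsub>powerset_algebra X\<^esub> S = \<Union>S"
    and powerset_inf: "S \<subseteq> Pow (topspace X) \<Longrightarrow> \<Sqinter>\<^bsub>powerset_algebra X\<^esub> S = topspace X \<inter> \<Inter>S"
    and powerset_join: "\<lbrakk>a \<subseteq> topspace X; b \<subseteq> topspace X\<rbrakk> \<Longrightarrow> a \<squnion>\<^bsub>powerset_algebra X\<^esub> b = a \<union> b"
    and powerset_meet: "\<lbrakk>a \<subseteq> topspace X; b \<subseteq> topspace X\<rbrakk> \<Longrightarrow> a \<sqinter>\<^bsub>powerset_algebra X\<^esub> b = a \<inter> b"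
    and powerset_bottom: "\<bottom>\<^bsub>powerset_algebra X\<^esub> = {}"
    and powerset_top: "\<top>\<^bsub>powerset_algebra X\<^esub> = topspace X"
proof -
  interpret partial_order "powerset_algebra X" by (rule partial_order_powerset)
  show 1: "S \<subseteq> Pow (topspace X) \<Longrightarrow> \<Squnion>\<^bsub>powerset_algebra X\<^esub> S = \<Union>S" for S
    by (intro sup_eqI powerset_least)
  show 2: "S \<subseteq> Pow (topspace X) \<Longrightarrow> \<Sqinter>\<^bsub>powerset_algebra X\<^esub> S = topspace X \<inter> \<Inter>S" for S
    by (intro inf_eqI powerset_greatest)
  show "\<lbrakk>a \<subseteq> topspace X; b \<subseteq> topspace X\<rbrakk> \<Longrightarrow> a \<squnion>\<^bsub>powerset_algebra X\<^esub> b = a \<union> b"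
    by (simp add: join_def 1)
  show "\<lbrakk>a \<subseteq> topspace X; b \<subseteq> topspace X\<rbrakk> \<Longrightarrow> a \<sqinter>\<^bsub>powerset_algebra X\<^esub> b = a \<inter> b"
    by (auto simp add: meet_def 2)
  show "\<bottom>\<^bsub>powerset_algebra X\<^esub> = {}"
    unfolding bottom_def by (rule some_equality) (auto simp: least_def)
  show "\<top>\<^bsub>powerset_algebra X\<^esub> = topspace X"
    unfolding top_def by (rule some_equality) (auto simp: greatest_def)
qed

lemma complete_boolean_lattice_powerset: "complete_boolean_lattice (powerset_algebra X)"
proof -
  interpret partial_order "powerset_algebra X" by (rule partial_order_powerset)
  show ?thesis
  proof unfold_locales
    fix a assume "a \<in> carrier (powerset_algebra X)"
    then show "\<exists>b\<in>carrier (powerset_algebra X). a \<sqinter>\<^bsub>powerset_algebra X\<^esub> b = \<bottom>\<^bsub>powerset_algebra X\<^esub> \<and>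
        a \<squnion>\<^bsub>powerset_algebra X\<^esub> b = \<top>\<^bsub>powerset_algebra X\<^esub>"
      by (intro bexI[of _ "topspace X - a"]) (auto simp: powerset_ops)
  next
    fix a b c assume "a \<in> carrier (powerset_algebra X)" "b \<in> carrier (powerset_algebra X)"
      "c \<in> carrier (powerset_algebra X)"
    then show "a \<sqinter>\<^bsub>powerset_algebra X\<^esub> (b \<squnion>\<^bsub>powerset_algebra X\<^esub> c) =
        (a \<sqinter>\<^bsub>powerset_algebra X\<^esub> b) \<squnion>\<^bsub>powerset_algebra X\<^esub> (a \<sqinter>\<^bsub>powerset_algebra X\<^esub> c)"
      by (simp add: powerset_ops le_infI1 Int_Un_distrib)
  qed (auto intro: powerset_least powerset_greatest)
qed

lemma powerset_complement:
  "a \<subseteq> topspace X \<Longrightarrow> \<sim>\<^bsub>powerset_algebra X\<^esub> a = topspace X - a"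
  by (rule complete_boolean_lattice.complement_eqI[OF complete_boolean_lattice_powerset])
    (auto simp: powerset_ops)

lemma de_vries_algebra_powerset: "de_vries_algebra (powerset_algebra X)"
proof -
  interpret complete_boolean_lattice "powerset_algebra X"
    by (rule complete_boolean_lattice_powerset)
  show ?thesis
    by unfold_locales (auto simp: powerset_ops powerset_complement)
qed

lemma regular_open_simps [simp]:
  "carrier (regular_open_algebra Y) = {U. regular_openin Y U}"
  "eq (regular_open_algebra Y) = (=)"
  "U \<sqsubseteq>\<^bsub>regular_open_algebra Y\<^esub> V \<longleftrightarrow> U \<subseteq> V"
  "U \<lless>\<^bsub>regular_open_algebra Y\<^esub> V \<longleftrightarrow> Y closure_of U \<subseteq> V"
  by (simp_all add: regular_open_algebra_def)

lemma partial_order_regular_open: "partial_order (regular_open_algebra Y)"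
  by unfold_locales auto

lemma regular_openin_openin: "regular_openin Y U \<Longrightarrow> openin Y U"
  unfolding regular_openin_def by (metis openin_interior_of)

lemma regular_openin_subset: "regular_openin Y U \<Longrightarrow> U \<subseteq> topspace Y"
  by (simp add: openin_subset regular_openin_openin)

lemma regular_openin_subset_closure: "regular_openin Y U \<Longrightarrow> U \<subseteq> Y closure_of U"
  by (simp add: closure_of_subset regular_openin_subset)

lemma interior_closure_mono:
  "U \<subseteq> V \<Longrightarrow> Y interior_of (Y closure_of U) \<subseteq> Y interior_of (Y closure_of V)"
  by (simp add: closure_of_mono interior_of_mono)

lemma interior_closure_increasing: "openin Y U \<Longrightarrow> U \<subseteq> Y interior_of (Y closure_of U)"
  by (simp add: closure_of_subset interior_of_maximal openin_subset)

lemma closure_interior_closure: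
  "Y closure_of (Y interior_of (Y closure_of U)) \<subseteq> Y closure_of U"
  by (intro closure_of_minimal) (auto simp: interior_of_subset)

lemma regular_openin_interior_closure [simp]: "regular_openin Y (Y interior_of (Y closure_of U))"
  unfolding regular_openin_def
  by (intro subset_antisym interior_closure_increasing interior_of_mono closure_interior_closure)
    simp

lemma interior_closure_least:
  "\<lbrakk>U \<subseteq> V; regular_openin Y V\<rbrakk> \<Longrightarrow> Y interior_of (Y closure_of U) \<subseteq> V"
  using interior_closure_mono[of U V Y] by (simp add: regular_openin_def)

lemma regular_openin_empty [simp]: "regular_openin Y {}"
  and regular_openin_topspace [simp]: "regular_openin Y (topspace Y)"
  by (simp_all add: regular_openin_def)

lemma regular_open_least:
  assumes "S \<subseteq> carrier (regular_open_algebra Y)"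
  shows "least (regular_open_algebra Y) (Y interior_of (Y closure_of \<Union>S))
    (Upper (regular_open_algebra Y) S)"
proof -
  have "openin Y (\<Union>S)" using assms by (auto intro: regular_openin_openin)
  then have "U \<subseteq> Y interior_of (Y closure_of \<Union>S)" if "U \<in> S" for U
    using interior_closure_increasing that by blast
  moreover have "Y interior_of (Y closure_of \<Union>S) \<subseteq> V"
    if "regular_openin Y V" "\<forall>U \<in> S. U \<subseteq> V" for V
    using that by (intro interior_closure_least) auto
  ultimately show ?thesis using assms
    by (simp add: least_def Upper_def) blast
qed

lemma regular_open_greatest:
  assumes "S \<subseteq> carrier (regular_open_algebra Y)"
  shows "greatest (regular_open_algebra Y)
    (Y interior_of (Y closure_of (Y interior_of (topspace Y \<inter> \<Inter>S)))) (Lower (regular_open_algebra Y) S)"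
proof -
  let ?I = "Y interior_of (topspace Y \<inter> \<Inter>S)"
  have "Y interior_of (Y closure_of ?I) \<subseteq> U" if "U \<in> S" for U
  proof -
    have "?I \<subseteq> U" using that interior_of_subset[of Y "topspace Y \<inter> \<Inter>S"] by blast
    then show ?thesis using assms that by (intro interior_closure_least) auto
  qed
  moreover have "V \<subseteq> Y interior_of (Y closure_of ?I)"
    if "regular_openin Y V" "\<forall>U \<in> S. V \<subseteq> U" for V
  proof -
    have "V \<subseteq> ?I"
      using that by (intro interior_of_maximal) (auto dest: regular_openin_subset regular_openin_openin)
    then show ?thesis
      using interior_closure_increasing[of Y ?I] by simp
  qed
  ultimately show ?thesis using assms
    by (simp add: greatest_def Lower_def) blast
qed

lemma regular_openin_Int:
  assumes "regular_openin Y U" "regular_openin Y V"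
  shows "regular_openin Y (U \<inter> V)"
  using assms unfolding regular_openin_def[of Y "U \<inter> V"]
  by (intro subset_antisym Int_greatest interior_closure_least interior_closure_increasing
      openin_Int regular_openin_openin) auto

lemma regular_open_ops:
  fixes Y :: "'y topology"
  defines "R \<equiv> regular_open_algebra Y"
  shows regular_open_sup: "S \<subseteq> carrier R \<Longrightarrow> \<Squnion>\<^bsub>R\<^esub> S = Y interior_of (Y closure_of \<Union>S)"
    and regular_open_join: "\<lbrakk>a \<in> carrier R; b \<in> carrier R\<rbrakk> \<Longrightarrow>
      a \<squnion>\<^bsub>R\<^esub> b = Y interior_of (Y closure_of (a \<union> b))"
    and regular_open_meet: "\<lbrakk>a \<in> carrier R; b \<in> carrier R\<rbrakk> \<Longrightarrow> a \<sqinter>\<^bsub>R\<^esub> b = a \<inter> b"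
    and regular_open_bottom: "\<bottom>\<^bsub>R\<^esub> = {}"
    and regular_open_top: "\<top>\<^bsub>R\<^esub> = topspace Y"
proof -
  interpret partial_order R unfolding R_def by (rule partial_order_regular_open)
  show 1: "S \<subseteq> carrier R \<Longrightarrow> \<Squnion>\<^bsub>R\<^esub> S = Y interior_of (Y closure_of \<Union>S)" for S
    by (intro sup_eqI) (simp add: R_def regular_open_least)
  show "\<lbrakk>a \<in> carrier R; b \<in> carrier R\<rbrakk> \<Longrightarrow> a \<squnion>\<^bsub>R\<^esub> b = Y interior_of (Y closure_of (a \<union> b))"
    by (simp add: join_def 1)
  show "\<lbrakk>a \<in> carrier R; b \<in> carrier R\<rbrakk> \<Longrightarrow> a \<sqinter>\<^bsub>R\<^esub> b = a \<inter> b"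
    unfolding meet_def
    by (rule inf_eqI) (auto simp: R_def greatest_def Lower_def regular_openin_Int)
  have bot: "least R {} (carrier R)" and top: "greatest R (topspace Y) (carrier R)"
    by (simp_all add: R_def least_def greatest_def regular_openin_subset)
  show "\<bottom>\<^bsub>R\<^esub> = {}"
    unfolding bottom_def using bot by (rule some_equality) (rule least_unique[OF _ bot])
  show "\<top>\<^bsub>R\<^esub> = topspace Y"
    unfolding top_def using top by (rule some_equality) (rule greatest_unique[OF _ top])
qed

lemma regular_open_compl:
  assumes "openin Y U"
  shows "regular_openin Y (topspace Y - Y closure_of U)"
    "Y interior_of (Y closure_of (U \<union> (topspace Y - Y closure_of U))) = topspace Y"
proof -
  have "Y interior_of (Y closure_of (topspace Y - Y closure_of U)) \<subseteq> topspace Y - Y closure_of U"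
  proof -
    have "Y closure_of (topspace Y - Y closure_of U) \<subseteq> topspace Y - U"
      using assms by (intro closure_of_minimal) (auto dest: closure_of_subset openin_subset)
    then show ?thesis
      by (metis interior_of_complement interior_of_mono)
  qed
  moreover have "openin Y (topspace Y - Y closure_of U)"
    by (rule openin_diff) simp_all
  ultimately show "regular_openin Y (topspace Y - Y closure_of U)"
    unfolding regular_openin_def by (intro subset_antisym interior_closure_increasing)
  have "topspace Y \<subseteq> Y closure_of (U \<union> (topspace Y - Y closure_of U))"
    using closure_of_subset[of "topspace Y - Y closure_of U" Y] unfolding closure_of_Un by blast
  then have "Y closure_of (U \<union> (topspace Y - Y closure_of U)) = topspace Y"
    by (intro subset_antisym closure_of_subset_topspace)
  then show "Y interior_of (Y closure_of (U \<union> (topspace Y - Y closure_of U))) = topspace Y"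
    by simp
qed

lemma complete_boolean_lattice_regular_open: "complete_boolean_lattice (regular_open_algebra Y)"
proof -
  let ?R = "regular_open_algebra Y"
  interpret partial_order ?R by (rule partial_order_regular_open)
  interpret complete_lattice ?R
    by unfold_locales (rule exI, erule regular_open_least, rule exI, erule regular_open_greatest)
  show ?thesis
  proof unfold_locales
    fix a assume "a \<in> carrier ?R"
    then show "\<exists>b\<in>carrier ?R. a \<sqinter>\<^bsub>?R\<^esub> b = \<bottom>\<^bsub>?R\<^esub> \<and> a \<squnion>\<^bsub>?R\<^esub> b = \<top>\<^bsub>?R\<^esub>"
      using regular_open_compl[of Y a, OF regular_openin_openin] regular_openin_subset_closure[of Y a]
      by (intro bexI[of _ "topspace Y - Y closure_of a"])
        (auto simp add: regular_open_ops simp del: closure_of_Un)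
  next
    fix a b c assume a: "a \<in> carrier ?R" and b: "b \<in> carrier ?R" and c: "c \<in> carrier ?R"
    have "a \<inter> Y interior_of (Y closure_of (b \<union> c)) \<subseteq> Y interior_of (Y closure_of (a \<inter> (b \<union> c)))"
    proof (rule interior_of_maximal)
      have "openin Y a" using a by (simp add: regular_openin_openin)
      then show "openin Y (a \<inter> Y interior_of (Y closure_of (b \<union> c)))" by (simp add: openin_Int)
      show "a \<inter> Y interior_of (Y closure_of (b \<union> c)) \<subseteq> Y closure_of (a \<inter> (b \<union> c))"
        using openin_Int_closure_of_subset[OF \<open>openin Y a\<close>, of "b \<union> c"]
          interior_of_subset[of Y "Y closure_of (b \<union> c)"] by blast
    qed
    moreover have "Y interior_of (Y closure_of (a \<inter> (b \<union> c))) \<subseteq> a \<inter> Y interior_of (Y closure_of (b \<union> c))"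
      using a by (intro Int_greatest interior_closure_least interior_closure_mono) auto
    ultimately have "a \<inter> Y interior_of (Y closure_of (b \<union> c)) = Y interior_of (Y closure_of ((a \<inter> b) \<union> (a \<inter> c)))"
      by (metis Int_Un_distrib subset_antisym)
    then show "a \<sqinter>\<^bsub>?R\<^esub> (b \<squnion>\<^bsub>?R\<^esub> c) = (a \<sqinter>\<^bsub>?R\<^esub> b) \<squnion>\<^bsub>?R\<^esub> (a \<sqinter>\<^bsub>?R\<^esub> c)"
      using a b c by (simp add: regular_open_ops regular_openin_Int del: closure_of_Un)
  qed
qed

lemma regular_open_complement:
  assumes "regular_openin Y a"
  shows "\<sim>\<^bsub>regular_open_algebra Y\<^esub> a = topspace Y - Y closure_of a"
  using assms regular_open_compl[of Y a, OF regular_openin_openin] regular_openin_subset_closure[of Y a]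
  by (intro complete_boolean_lattice.complement_eqI[OF complete_boolean_lattice_regular_open])
    (auto simp add: regular_open_ops simp del: closure_of_Un)

lemma regular_open_neighbourhood:
  assumes "regular_space Y" "openin Y V" "y \<in> V"
  obtains U where "regular_openin Y U" "y \<in> U" "Y closure_of U \<subseteq> V"
proof -
  have "closedin Y (topspace Y - V)" "y \<in> topspace Y - (topspace Y - V)"
    using assms by (auto dest: openin_subset)
  then obtain W where W: "openin Y W" "y \<in> W" "disjnt (topspace Y - V) (Y closure_of W)"
    using assms(1) unfolding regular_space by blast
  show thesis
  proof
    show "y \<in> Y interior_of (Y closure_of W)" using W interior_closure_increasing by blast
    show "Y closure_of (Y interior_of (Y closure_of W)) \<subseteq> V"
      using W(3) closure_interior_closure[of Y W] closure_of_subset_topspace[of Y W]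
      unfolding disjnt_def by blast
  qed simp
qed

lemma de_vries_algebra_regular_open:
  assumes "compact_space Y" "Hausdorff_space Y"
  shows "de_vries_algebra (regular_open_algebra Y)"
proof -
  let ?R = "regular_open_algebra Y"
  interpret complete_boolean_lattice ?R by (rule complete_boolean_lattice_regular_open)
  have reg: "regular_space Y" and norm: "normal_space Y"
    using assms compact_Hausdorff_imp_regular_space compact_Hausdorff_or_regular_imp_normal_space
    by blast+
  show ?thesis
  proof unfold_locales
    fix a b assume a: "a \<in> carrier ?R" and b: "b \<in> carrier ?R" and ab: "a \<lless>\<^bsub>?R\<^esub> b"
    show "a \<sqsubseteq>\<^bsub>?R\<^esub> b"
      using a ab regular_openin_subset_closure[of Y a] by auto
    have "Y closure_of (topspace Y - Y closure_of b) \<subseteq> topspace Y - b"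
      using b regular_openin_subset_closure[of Y b]
      by (intro closure_of_minimal) (auto simp: regular_openin_openin)
    then show "\<sim>\<^bsub>?R\<^esub> b \<lless>\<^bsub>?R\<^esub> \<sim>\<^bsub>?R\<^esub> a"
      using a b ab by (auto simp: regular_open_complement)
    obtain W where W: "openin Y W" "Y closure_of a \<subseteq> W" "Y closure_of W \<subseteq> b"
      using norm a b ab regular_openin_openin[of Y b] unfolding normal_space_alt
      by (metis (mono_tags, lifting) closedin_closure_of mem_Collect_eq regular_open_simps(1,4))
    show "\<exists>c\<in>carrier ?R. a \<lless>\<^bsub>?R\<^esub> c \<and> c \<lless>\<^bsub>?R\<^esub> b"
      using W interior_closure_increasing[OF W(1)] closure_interior_closure[of Y W]
      by (intro bexI[of _ "Y interior_of (Y closure_of W)"]) auto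
  next
    fix b assume b: "b \<in> carrier ?R" "b \<noteq> \<bottom>\<^bsub>?R\<^esub>"
    then obtain y where "y \<in> b" by (auto simp: regular_open_ops)
    with b obtain U where "regular_openin Y U" "y \<in> U" "Y closure_of U \<subseteq> b"
      using regular_open_neighbourhood[OF reg, of b y] regular_openin_openin[of Y b] by auto
    then show "\<exists>a\<in>carrier ?R. a \<noteq> \<bottom>\<^bsub>?R\<^esub> \<and> a \<lless>\<^bsub>?R\<^esub> b"
      by (intro bexI[of _ U]) (auto simp: regular_open_ops)
  next
    fix a b c d assume "a \<sqsubseteq>\<^bsub>?R\<^esub> b" "b \<lless>\<^bsub>?R\<^esub> c" "c \<sqsubseteq>\<^bsub>?R\<^esub> d"
    then show "a \<lless>\<^bsub>?R\<^esub> d" using closure_of_mono[of a b Y] by auto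
  qed (auto simp: regular_open_ops)
qed

lemma de_vries_extension_compactification:
  assumes "compactification X Y e"
  shows "de_vries_extension (regular_open_algebra Y) (powerset_algebra X) (preimage_map X e)"
proof -
  have comp: "compact_space Y" and haus: "Hausdorff_space Y" and emb: "embedding_map X Y e"
    and dense: "Y closure_of (e ` topspace X) = topspace Y"
    using assms by (auto simp: compactification_def)
  have reg: "regular_space Y" using comp haus by (rule compact_Hausdorff_imp_regular_space)
  have eX: "\<And>x. x \<in> topspace X \<Longrightarrow> e x \<in> topspace Y" using embedding_map_image[OF emb] by blast
  have inj: "inj_on e (topspace X)"
    using emb by (simp add: embedding_map_def homeomorphic_imp_injective_map)
  have sub: "preimage_map X e U \<subseteq> topspace X" for U by (auto simp: preimage_map_def)
  interpret R: de_vries_algebra "regular_open_algebra Y"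
    by (rule de_vries_algebra_regular_open[OF comp haus])
  interpret P: de_vries_algebra "powerset_algebra X" by (rule de_vries_algebra_powerset)
  show ?thesis
  proof unfold_locales
    show "preimage_map X e \<in> carrier (regular_open_algebra Y) \<rightarrow> carrier (powerset_algebra X)"
      using sub by auto
    show "preimage_map X e \<bottom>\<^bsub>regular_open_algebra Y\<^esub> = \<bottom>\<^bsub>powerset_algebra X\<^esub>"
      by (simp add: regular_open_ops powerset_ops preimage_map_def)
  next
    fix a b assume a: "a \<in> carrier (regular_open_algebra Y)" and b: "b \<in> carrier (regular_open_algebra Y)"
    then show "preimage_map X e (a \<sqinter>\<^bsub>regular_open_algebra Y\<^esub> b) =
        preimage_map X e a \<sqinter>\<^bsub>powerset_algebra X\<^esub> preimage_map X e b"
      by (auto simp: regular_open_ops powerset_ops sub) (auto simp: preimage_map_def)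
    assume "a \<lless>\<^bsub>regular_open_algebra Y\<^esub> b"
    then show "\<sim>\<^bsub>powerset_algebra X\<^esub> (preimage_map X e (\<sim>\<^bsub>regular_open_algebra Y\<^esub> a))
        \<lless>\<^bsub>powerset_algebra X\<^esub> preimage_map X e b"
      using a b eX
      by (auto simp: regular_open_complement powerset_complement sub) (auto simp: preimage_map_def)
  next
    fix b assume b: "b \<in> carrier (regular_open_algebra Y)"
    let ?S = "{preimage_map X e a | a. a \<in> carrier (regular_open_algebra Y) \<and> a \<lless>\<^bsub>regular_open_algebra Y\<^esub> b}"
    have "preimage_map X e b \<subseteq> \<Union>?S"
    proof
      fix x assume x: "x \<in> preimage_map X e b"
      then obtain U where "regular_openin Y U" "e x \<in> U" "Y closure_of U \<subseteq> b"
        using regular_open_neighbourhood[OF reg, of b "e x"] regular_openin_openin[of Y b] b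
        by (auto simp: preimage_map_def)
      then show "x \<in> \<Union>?S"
        using x by (intro UnionI[of "preimage_map X e U"]) (auto simp: preimage_map_def)
    qed
    moreover have "\<Union>?S \<subseteq> preimage_map X e b"
      using R.DV2[OF _ b] by (fastforce simp: preimage_map_def)
    moreover have "?S \<subseteq> Pow (topspace X)" using sub by auto
    ultimately show "preimage_map X e b = \<Squnion>\<^bsub>powerset_algebra X\<^esub> ?S"
      by (simp only: powerset_sup subset_antisym)
  next
    have le: "U \<subseteq> V" if U: "regular_openin Y U" and V: "regular_openin Y V"
      and eq: "preimage_map X e U = preimage_map X e V" for U V
    proof -
      have "U \<subseteq> Y closure_of (e ` topspace X)" using dense regular_openin_subset[OF U] by simp
      then have "Y closure_of U = Y closure_of (U \<inter> e ` topspace X)"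
        using closure_of_openin_Int_superset regular_openin_openin[OF U] by metis
      also have "U \<inter> e ` topspace X \<subseteq> V" using eq by (auto simp: preimage_map_def)
      then have "Y closure_of (U \<inter> e ` topspace X) \<subseteq> Y closure_of V" by (rule closure_of_mono)
      finally have "Y interior_of (Y closure_of U) \<subseteq> Y interior_of (Y closure_of V)"
        by (rule interior_of_mono)
      with U V show ?thesis by (simp add: regular_openin_def)
    qed
    show "inj_on (preimage_map X e) (carrier (regular_open_algebra Y))"
      by (rule inj_onI, rule subset_antisym) (use le in simp_all)
  next
    show "extremally_disconnected (powerset_algebra X)" by (simp add: extremally_disconnected_def)
    show "atomic (powerset_algebra X)"
      unfolding atomic_def
    proof (intro ballI impI)
      fix b assume "b \<in> carrier (powerset_algebra X)" "b \<noteq> \<bottom>\<^bsub>powerset_algebra X\<^esub>"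
      then obtain x where "x \<in> b" "x \<in> topspace X" by (auto simp: powerset_ops)
      then show "\<exists>a. lattice_atom (powerset_algebra X) a \<and> a \<sqsubseteq>\<^bsub>powerset_algebra X\<^esub> b"
        by (intro exI[of _ "{x}"]) (auto simp: lattice_atom_def powerset_ops)
    qed
  next
    fix b assume "b \<in> carrier (powerset_algebra X)"
    then have b: "b \<subseteq> topspace X" by simp
    define T where "T x = preimage_map X e ` {U. regular_openin Y U \<and> e x \<in> U}" for x
    have inf: "\<Sqinter>\<^bsub>powerset_algebra X\<^esub> (T x) = {x}" if x: "x \<in> topspace X" for x
    proof -
      have "z = x" if z: "z \<in> topspace X" "z \<in> \<Inter> (T x)" for z
      proof (rule ccontr)
        assume "z \<noteq> x"
        then have "e z \<noteq> e x" using inj x z by (auto dest: inj_onD)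
        moreover have "openin Y (topspace Y - {e z})"
          using haus eX[OF z(1)] Hausdorff_imp_t1_space t1_space_closedin_singleton
          by (metis openin_diff openin_topspace)
        ultimately obtain U where "regular_openin Y U" "e x \<in> U"
            "Y closure_of U \<subseteq> topspace Y - {e z}"
          using regular_open_neighbourhood[OF reg, of "topspace Y - {e z}" "e x"] eX[OF x] by auto
        moreover from this have "U \<subseteq> topspace Y - {e z}"
          using regular_openin_subset_closure[of Y U] by blast
        ultimately show False using z(2) by (auto simp: T_def preimage_map_def)
      qed
      then have "topspace X \<inter> \<Inter> (T x) = {x}"
        using x by (auto simp: T_def preimage_map_def)
      moreover have "T x \<subseteq> Pow (topspace X)" using sub by (auto simp: T_def)
      ultimately show ?thesis by (simp add: powerset_inf)
    qed
    have "{\<Sqinter>\<^bsub>powerset_algebra X\<^esub> t | t. t \<in> T ` b} = (\<lambda>x. {x}) ` b"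
      using inf b by (auto simp: image_iff)
    then have "b = \<Squnion>\<^bsub>powerset_algebra X\<^esub> {\<Sqinter>\<^bsub>powerset_algebra X\<^esub> t | t. t \<in> T ` b}"
      using b by (subst powerset_sup) auto
    moreover have "\<forall>t \<in> T ` b. t \<subseteq> preimage_map X e ` carrier (regular_open_algebra Y)"
      by (auto simp: T_def)
    ultimately show "\<exists>\<T>. (\<forall>t\<in>\<T>. t \<subseteq> preimage_map X e ` carrier (regular_open_algebra Y)) \<and>
        b = \<Squnion>\<^bsub>powerset_algebra X\<^esub> {\<Sqinter>\<^bsub>powerset_algebra X\<^esub> t | t. t \<in> \<T>}"
      by blast
  qed
qed

end

theory Submission
  imports Defs
begin

text \<open>
  Compatible extensions of de Vries algebras put two proximities on the same Boolean algebra of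
  images, and a comparison morphism exists iff one of these proximities contains the other. So an
  extension is maximal iff its proximity contains that of every compatible extension.

  Preimages identify the regular open sets of any compactification with those of \<open>X\<close>, where
  \<open>S \<prec> T\<close> means that \<open>S\<close> and \<open>X - T\<close> have disjoint closures in the compactification. By
  Taimanov's extension theorem, one compactification lies above another iff its proximity contains
  the other's. In a compatible extension, interpolation as in Urysohn's lemma separates related sets
  by a continuous function, which extends to \<open>\<beta>X\<close>; hence \<open>\<beta>X\<close> has the greatest proximity of all,
  and \<open>e\<^sup>-\<^sup>1\<close> is maximal iff \<open>e\<close> lies above \<open>\<beta>X\<close>.
\<close>


section \<open>Proximities of compatible extensions\<close>

lemma (in complete_boolean_lattice) complement_complement:
  assumes "a \<in> carrier L"
  shows "\<sim> (\<sim> a) = a"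
  using assms complement[OF assms] meet_comm[of L a "\<sim> a"] join_comm[of L a "\<sim> a"]
  by (intro complement_eqI) simp_all

lemma (in complete_boolean_lattice) le_if_meet_complement_eq_bottom:
  assumes "a \<in> carrier L" "b \<in> carrier L" "a \<sqinter> \<sim> b = \<bottom>"
  shows "a \<sqsubseteq> b"
  using assms le_complement[of "\<sim> b" a] meet_comm[of L a "\<sim> b"]
  by (simp add: complement complement_complement)

lemma (in de_vries_algebra) prox_trans:
  assumes "a \<in> carrier A" "b \<in> carrier A" "c \<in> carrier A" "a \<lless> b" "b \<lless> c"
  shows "a \<lless> c"
  using DV3[of a b c c] DV2[of a b] assms by simp

context de_vries_morphism
begin

lemma image_closed: "a \<in> carrier A \<Longrightarrow> \<rho> a \<in> carrier B"
  using closed by blast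

lemma mono:
  assumes "a \<in> carrier A" "b \<in> carrier A" "a \<sqsubseteq>\<^bsub>A\<^esub> b"
  shows "\<rho> a \<sqsubseteq>\<^bsub>B\<^esub> \<rho> b"
proof -
  have "\<rho> a \<sqinter>\<^bsub>B\<^esub> \<rho> b = \<rho> a"
    using assms M2[of a b] source.le_iff_join[of a b] by simp
  then show ?thesis
    using assms target.le_iff_join[of "\<rho> a" "\<rho> b"] by (simp add: image_closed)
qed

lemma meet_image_complement:
  assumes "a \<in> carrier A"
  shows "\<rho> a \<sqinter>\<^bsub>B\<^esub> \<rho> (\<sim>\<^bsub>A\<^esub> a) = \<bottom>\<^bsub>B\<^esub>"
  using assms M2[of a "\<sim>\<^bsub>A\<^esub> a"] M1 by (simp add: source.complement)

lemma prox_mono: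
  assumes "a \<in> carrier A" "b \<in> carrier A" "a \<lless>\<^bsub>A\<^esub> b"
  shows "\<rho> a \<lless>\<^bsub>B\<^esub> \<rho> b"
proof (rule target.DV3)
  show "\<rho> a \<sqsubseteq>\<^bsub>B\<^esub> \<sim>\<^bsub>B\<^esub> \<rho> (\<sim>\<^bsub>A\<^esub> a)"
    using assms(1) meet_image_complement[of a] meet_comm[of B "\<rho> a" "\<rho> (\<sim>\<^bsub>A\<^esub> a)"]
    by (intro target.le_complement) (simp_all add: image_closed source.complement)
  show "\<sim>\<^bsub>B\<^esub> \<rho> (\<sim>\<^bsub>A\<^esub> a) \<lless>\<^bsub>B\<^esub> \<rho> b"
    using assms by (rule M3)
qed (use assms in \<open>simp_all add: image_closed source.complement target.complement\<close>)

lemma image_le_if_prox_images_le: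
  assumes "b \<in> carrier A" "u \<in> carrier B"
    and "\<And>a. \<lbrakk>a \<in> carrier A; a \<lless>\<^bsub>A\<^esub> b\<rbrakk> \<Longrightarrow> \<rho> a \<sqsubseteq>\<^bsub>B\<^esub> u"
  shows "\<rho> b \<sqsubseteq>\<^bsub>B\<^esub> u"
  unfolding M4[OF assms(1)] using assms by (intro target.sup_least) (auto simp: image_closed)

end

definition image_prox :: "'a proximity_order \<Rightarrow> ('a \<Rightarrow> 'b) \<Rightarrow> 'b \<Rightarrow> 'b \<Rightarrow> bool" where
  "image_prox A \<alpha> s t \<longleftrightarrow> (\<exists>a \<in> carrier A. \<exists>b \<in> carrier A. s = \<alpha> a \<and> t = \<alpha> b \<and> a \<lless>\<^bsub>A\<^esub> b)"

context de_vries_extension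
begin

lemma image_prox_iff:
  assumes "a \<in> carrier A" "b \<in> carrier A"
  shows "image_prox A \<alpha> (\<alpha> a) (\<alpha> b) \<longleftrightarrow> a \<lless>\<^bsub>A\<^esub> b"
  using assms inj by (auto simp: image_prox_def dest: inj_onD)

lemma image_prox_interpolation:
  assumes "image_prox A \<alpha> s t"
  shows "\<exists>u. image_prox A \<alpha> s u \<and> image_prox A \<alpha> u t"
  using assms source.DV6 unfolding image_prox_def by metis

lemma image_prox_trans:
  assumes "image_prox A \<alpha> s t" "image_prox A \<alpha> t u"
  shows "image_prox A \<alpha> s u"
proof -
  obtain a b b' c where "a \<in> carrier A" "b \<in> carrier A" "b' \<in> carrier A" "c \<in> carrier A"
    and "s = \<alpha> a" "t = \<alpha> b" "t = \<alpha> b'" "u = \<alpha> c" and "a \<lless>\<^bsub>A\<^esub> b" "b' \<lless>\<^bsub>A\<^esub> c"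
    using assms unfolding image_prox_def by metis
  moreover from this have "b = b'"
    using inj by (auto dest: inj_onD)
  ultimately show ?thesis
    using source.prox_trans[of a b c] by (auto simp: image_prox_iff)
qed

end

locale compatible_extensions = A: de_vries_extension A B \<alpha> + C: de_vries_extension C B \<gamma>
  for A :: "'a proximity_order" and B :: "'b proximity_order" and C :: "'c proximity_order"
    and \<alpha> :: "'a \<Rightarrow> 'b" and \<gamma> :: "'c \<Rightarrow> 'b" +
  assumes compatible: "compatible A \<alpha> C \<gamma>"
begin

definition counterpart :: "'c \<Rightarrow> 'a" where
  "counterpart c = inv_into (carrier A) \<alpha> (\<gamma> c)"

lemma counterpart:
  assumes "c \<in> carrier C"
  shows "counterpart c \<in> carrier A" and image_counterpart: "\<alpha> (counterpart c) = \<gamma> c"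
proof -
  have "\<gamma> c \<in> \<alpha> ` carrier A"
    using assms compatible by (simp add: compatible_def)
  then show "counterpart c \<in> carrier A" "\<alpha> (counterpart c) = \<gamma> c"
    unfolding counterpart_def by (rule inv_into_into, rule f_inv_into_f)
qed

lemma counterpart_eqI: "\<lbrakk>c \<in> carrier C; a \<in> carrier A; \<alpha> a = \<gamma> c\<rbrakk> \<Longrightarrow> counterpart c = a"
  using A.inj counterpart by (metis inj_onD)

lemma counterpart_surj:
  assumes "a \<in> carrier A"
  obtains c where "c \<in> carrier C" "counterpart c = a"
proof -
  have "\<alpha> a \<in> \<gamma> ` carrier C"
    using assms compatible by (auto simp: compatible_def)
  then show thesis
    using that assms counterpart_eqI by auto
qed

lemma counterpart_le_iff:
  assumes "c \<in> carrier C" "d \<in> carrier C"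
  shows "counterpart c \<sqsubseteq>\<^bsub>A\<^esub> counterpart d \<longleftrightarrow> c \<sqsubseteq>\<^bsub>C\<^esub> d"
  using assms A.le_iff[of "counterpart c" "counterpart d"] C.le_iff[of c d]
  by (simp add: counterpart)

lemma counterpart_bottom: "counterpart \<bottom>\<^bsub>C\<^esub> = \<bottom>\<^bsub>A\<^esub>"
  by (rule counterpart_eqI) (simp_all add: A.M1 C.M1)

lemma counterpart_meet:
  assumes "c \<in> carrier C" "d \<in> carrier C"
  shows "counterpart (c \<sqinter>\<^bsub>C\<^esub> d) = counterpart c \<sqinter>\<^bsub>A\<^esub> counterpart d"
  using assms by (intro counterpart_eqI) (simp_all add: counterpart A.M2 C.M2)

lemma complement_counterpart_complement_le:
  assumes c_closed: "c \<in> carrier C"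
  shows "\<sim>\<^bsub>A\<^esub> counterpart (\<sim>\<^bsub>C\<^esub> c) \<sqsubseteq>\<^bsub>A\<^esub> counterpart c"
proof -
  have complement_closed: "\<sim>\<^bsub>C\<^esub> c \<in> carrier C" "counterpart (\<sim>\<^bsub>C\<^esub> c) \<in> carrier A"
    using c_closed by (simp_all add: C.source.complement counterpart)
  then obtain d where d: "d \<in> carrier C" "counterpart d = \<sim>\<^bsub>A\<^esub> counterpart (\<sim>\<^bsub>C\<^esub> c)"
    using A.source.complement(1) counterpart_surj by metis
  have "counterpart (d \<sqinter>\<^bsub>C\<^esub> \<sim>\<^bsub>C\<^esub> c) = counterpart \<bottom>\<^bsub>C\<^esub>"
    using d complement_closed A.source.complement(2)[OF complement_closed(2)]
      meet_comm[of A "counterpart d"]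
    by (simp add: counterpart_meet counterpart_bottom)
  then have "d \<sqinter>\<^bsub>C\<^esub> \<sim>\<^bsub>C\<^esub> c = \<bottom>\<^bsub>C\<^esub>"
    using d(1) complement_closed(1) C.inj image_counterpart
    by (metis C.source.bottom_closed C.source.meet_closed inj_onD)
  then have "d \<sqsubseteq>\<^bsub>C\<^esub> c"
    using c_closed d(1) by (intro C.source.le_if_meet_complement_eq_bottom)
  then show ?thesis
    using c_closed d by (simp flip: counterpart_le_iff)
qed

lemma counterpart_le_if_prox_counterparts_le:
  assumes d_closed: "d \<in> carrier C" and u_closed: "u \<in> carrier A"
    and prox_le: "\<And>c. \<lbrakk>c \<in> carrier C; c \<lless>\<^bsub>C\<^esub> d\<rbrakk> \<Longrightarrow> counterpart c \<sqsubseteq>\<^bsub>A\<^esub> u"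
  shows "counterpart d \<sqsubseteq>\<^bsub>A\<^esub> u"
proof -
  have "\<gamma> c \<sqsubseteq>\<^bsub>B\<^esub> \<alpha> u" if "c \<in> carrier C" "c \<lless>\<^bsub>C\<^esub> d" for c
    using prox_le[OF that] that(1) u_closed A.le_iff[of "counterpart c" u]
    by (simp add: counterpart)
  then have "\<gamma> d \<sqsubseteq>\<^bsub>B\<^esub> \<alpha> u"
    by (rule C.image_le_if_prox_images_le[OF d_closed A.image_closed[OF u_closed]])
  then show ?thesis
    using d_closed u_closed A.le_iff[of "counterpart d" u] by (simp add: counterpart)
qed

lemma counterpart_morphism:
  assumes image_prox_le: "image_prox C \<gamma> \<le> image_prox A \<alpha>"
  shows "de_vries_morphism C A counterpart"
proof unfold_locales
  have prox: "counterpart c \<lless>\<^bsub>A\<^esub> counterpart d"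
    if "c \<in> carrier C" "d \<in> carrier C" "c \<lless>\<^bsub>C\<^esub> d" for c d
    using that image_prox_le A.image_prox_iff[of "counterpart c" "counterpart d"]
      C.image_prox_iff[of c d]
    by (auto simp: counterpart)
  show "counterpart \<in> carrier C \<rightarrow> carrier A"
    by (auto simp: counterpart)
  show "counterpart \<bottom>\<^bsub>C\<^esub> = \<bottom>\<^bsub>A\<^esub>"
    by (rule counterpart_bottom)
  fix c d assume c_closed: "c \<in> carrier C" and d_closed: "d \<in> carrier C"
  then show "counterpart (c \<sqinter>\<^bsub>C\<^esub> d) = counterpart c \<sqinter>\<^bsub>A\<^esub> counterpart d"
    by (rule counterpart_meet)
  assume "c \<lless>\<^bsub>C\<^esub> d"
  with c_closed d_closed show "\<sim>\<^bsub>A\<^esub> counterpart (\<sim>\<^bsub>C\<^esub> c) \<lless>\<^bsub>A\<^esub> counterpart d"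
    using prox[of c d] complement_counterpart_complement_le[of c]
      A.source.DV3[of "\<sim>\<^bsub>A\<^esub> counterpart (\<sim>\<^bsub>C\<^esub> c)" "counterpart c"
        "counterpart d" "counterpart d"]
    by (simp add: counterpart A.source.complement C.source.complement)
next
  fix d assume d_closed: "d \<in> carrier C"
  let ?S = "{counterpart c | c. c \<in> carrier C \<and> c \<lless>\<^bsub>C\<^esub> d}"
  have S_closed: "?S \<subseteq> carrier A"
    by (auto simp: counterpart)
  show "counterpart d = \<Squnion>\<^bsub>A\<^esub> ?S"
  proof (rule A.source.le_antisym)
    show "counterpart d \<sqsubseteq>\<^bsub>A\<^esub> \<Squnion>\<^bsub>A\<^esub> ?S"
      by (rule counterpart_le_if_prox_counterparts_le[OF d_closed A.source.sup_closed[OF S_closed]])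
        (use A.source.sup_upper[OF S_closed] in blast)
    show "\<Squnion>\<^bsub>A\<^esub> ?S \<sqsubseteq>\<^bsub>A\<^esub> counterpart d"
      using d_closed C.source.DV2
      by (intro A.source.sup_least[OF S_closed]) (auto simp: counterpart counterpart_le_iff)
  qed (simp_all add: d_closed counterpart A.source.sup_closed[OF S_closed])
qed

lemma dv_compose_counterpart:
  assumes "c \<in> carrier C"
  shows "dv_compose C B \<alpha> counterpart c = \<gamma> c"
proof -
  have "{\<alpha> (counterpart d) | d. d \<in> carrier C \<and> d \<lless>\<^bsub>C\<^esub> c} = {\<gamma> d | d. d \<in> carrier C \<and> d \<lless>\<^bsub>C\<^esub> c}"
    using image_counterpart by metis
  with C.M4[OF assms] show ?thesis
    by (simp add: dv_compose_def)
qed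

lemma image_prox_le_if_morphism:
  assumes \<delta>: "de_vries_morphism C A \<delta>"
    and comp: "\<And>c. c \<in> carrier C \<Longrightarrow> dv_compose C B \<alpha> \<delta> c = \<gamma> c"
  shows "image_prox C \<gamma> \<le> image_prox A \<alpha>"
proof (intro predicate2I)
  interpret \<delta>: de_vries_morphism C A \<delta> by (rule \<delta>)
  let ?S = "\<lambda>d. {\<alpha> (\<delta> c) | c. c \<in> carrier C \<and> c \<lless>\<^bsub>C\<^esub> d}"
  have images_closed: "?S d \<subseteq> carrier B" and \<gamma>_eq_sup: "\<gamma> d = \<Squnion>\<^bsub>B\<^esub> ?S d" if "d \<in> carrier C" for d
    using comp[OF that] by (auto simp: dv_compose_def A.image_closed \<delta>.image_closed)
  have below: "counterpart d \<sqsubseteq>\<^bsub>A\<^esub> \<delta> d" if d_closed: "d \<in> carrier C" for d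
  proof -
    have "\<gamma> d \<sqsubseteq>\<^bsub>B\<^esub> \<alpha> (\<delta> d)"
      unfolding \<gamma>_eq_sup[OF d_closed] using d_closed images_closed[OF d_closed] C.source.DV2[of _ d]
      by (intro A.target.sup_least) (auto simp: A.mono \<delta>.mono A.image_closed \<delta>.image_closed)
    then show ?thesis
      using d_closed A.le_iff[of "counterpart d" "\<delta> d"] by (simp add: counterpart \<delta>.image_closed)
  qed
  have above: "\<delta> c \<sqsubseteq>\<^bsub>A\<^esub> counterpart d" if "c \<in> carrier C" "d \<in> carrier C" "c \<lless>\<^bsub>C\<^esub> d" for c d
  proof -
    have "\<alpha> (\<delta> c) \<sqsubseteq>\<^bsub>B\<^esub> \<gamma> d"
      unfolding \<gamma>_eq_sup[OF that(2)] using that images_closed[OF that(2)]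
      by (intro A.target.sup_upper) auto
    then show ?thesis
      using that A.le_iff[of "\<delta> c" "counterpart d"] by (simp add: counterpart \<delta>.image_closed)
  qed
  fix s t assume "image_prox C \<gamma> s t"
  then obtain c d where prox_cd: "c \<in> carrier C" "d \<in> carrier C" "s = \<gamma> c" "t = \<gamma> d" "c \<lless>\<^bsub>C\<^esub> d"
    unfolding image_prox_def by blast
  then obtain c' where interpolant: "c' \<in> carrier C" "c \<lless>\<^bsub>C\<^esub> c'" "c' \<lless>\<^bsub>C\<^esub> d"
    using C.source.DV6[of c d] by blast
  have "counterpart c \<lless>\<^bsub>A\<^esub> counterpart d"
    using prox_cd interpolant below[of c] \<delta>.prox_mono[of c c'] above[of c' d]
      A.source.DV3[of "counterpart c" "\<delta> c" "\<delta> c'" "counterpart d"]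
    by (simp add: counterpart \<delta>.image_closed)
  then show "image_prox A \<alpha> s t"
    using prox_cd A.image_prox_iff[of "counterpart c" "counterpart d"] by (simp add: counterpart)
qed

end

lemma maximal_extension_imp_image_prox_le:
  fixes C :: "'c proximity_order"
  assumes "maximal_extension A B \<alpha>" "de_vries_extension C B \<gamma>" "compatible A \<alpha> C \<gamma>"
  shows "image_prox C \<gamma> \<le> image_prox A \<alpha>"
proof -
  interpret compatible_extensions A B C \<alpha> \<gamma>
    using assms by (simp add: compatible_extensions_def compatible_extensions_axioms_def
        maximal_extension_def)
  show ?thesis
    using maximal_extension_universal[OF assms] image_prox_le_if_morphism by blast
qed

lemma maximal_extensionI:
  fixes A :: "'a proximity_order"
  assumes \<alpha>: "de_vries_extension A B \<alpha>"
    and image_prox_le: "\<And>(C :: 'a proximity_order) \<gamma>. \<lbrakk>de_vries_extension C B \<gamma>; compatible A \<alpha> C \<gamma>\<rbrakk>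
      \<Longrightarrow> image_prox C \<gamma> \<le> image_prox A \<alpha>"
  shows "maximal_extension A B \<alpha>"
  unfolding maximal_extension_def
proof (intro conjI allI impI \<alpha>)
  fix C :: "'a proximity_order" and \<gamma>
  assume C: "de_vries_extension C B \<gamma> \<and> compatible A \<alpha> C \<gamma>"
  then interpret compatible_extensions A B C \<alpha> \<gamma>
    using \<alpha> by (simp add: compatible_extensions_def compatible_extensions_axioms_def)
  show "\<exists>\<delta>. de_vries_morphism C A \<delta> \<and> (\<forall>c \<in> carrier C. dv_compose C B \<alpha> \<delta> c = \<gamma> c)"
    using C image_prox_le counterpart_morphism dv_compose_counterpart by blast
qed


section \<open>The proximity induced by a dense embedding\<close>

lemma image_preimage_map: "e ` preimage_map X e U = U \<inter> e ` topspace X"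
  by (auto simp: preimage_map_def)

lemma preimage_map_mono: "U \<subseteq> V \<Longrightarrow> preimage_map X e U \<subseteq> preimage_map X e V"
  by (auto simp: preimage_map_def)

lemma disjnt_closures_of_if_images:
  assumes "continuous_map Y Z g" "disjnt (Z closure_of (g ` A)) (Z closure_of (g ` B))"
  shows "disjnt (Y closure_of A) (Y closure_of B)"
  using assms(2) continuous_map_image_closure_subset[OF assms(1), of A]
    continuous_map_image_closure_subset[OF assms(1), of B]
  by (auto simp: disjnt_iff)

abbreviation induced_prox ::
    "'x topology \<Rightarrow> 'y topology \<Rightarrow> ('x \<Rightarrow> 'y) \<Rightarrow> 'x set \<Rightarrow> 'x set \<Rightarrow> bool" where
  "induced_prox X Y e \<equiv> image_prox (regular_open_algebra Y) (preimage_map X e)"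

locale dense_embedding =
  fixes X :: "'x topology" and Y :: "'y topology" and e :: "'x \<Rightarrow> 'y"
  assumes embedding: "embedding_map X Y e"
    and dense: "Y closure_of (e ` topspace X) = topspace Y"
begin

lemma continuous: "continuous_map X Y e"
  using homeomorphic_imp_continuous_map[OF embedding[unfolded embedding_map_def]]
  by (simp add: continuous_map_in_subtopology)

lemma openin_preimage_map: "openin Y U \<Longrightarrow> openin X (preimage_map X e U)"
  using openin_continuous_map_preimage[OF continuous] by (simp add: preimage_map_def)

lemma openin_eq_preimage_map:
  assumes "openin X V"
  obtains U where "openin Y U" "preimage_map X e U = V"
proof -
  have hom: "homeomorphic_map X (subtopology Y (e ` topspace X)) e"
    using embedding by (simp add: embedding_map_def)
  then have "openin (subtopology Y (e ` topspace X)) (e ` V)"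
    using assms homeomorphic_imp_open_map by (auto simp: open_map_def)
  then obtain U where U: "openin Y U" "e ` V = U \<inter> e ` topspace X"
    by (auto simp: openin_subtopology)
  have "e ` preimage_map X e U = e ` V"
    using U(2) by (simp add: image_preimage_map)
  then have "preimage_map X e U = V"
    using homeomorphic_imp_injective_map[OF hom] openin_subset[OF assms]
    by (subst (asm) inj_on_image_eq_iff) (auto simp: preimage_map_def)
  with U(1) show thesis
    by (rule that)
qed

lemma preimage_map_nonempty:
  assumes "openin Y U" "U \<noteq> {}"
  shows "preimage_map X e U \<noteq> {}"
proof -
  have "e ` topspace X \<inter> U \<noteq> {}"
    using assms dense dense_intersects_open by metis
  then show ?thesis
    by (auto simp: preimage_map_def)
qed

lemma closure_of_image_preimage_map:
  assumes "openin Y U"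
  shows "Y closure_of (e ` preimage_map X e U) = Y closure_of U"
  unfolding image_preimage_map
  using assms openin_subset[OF assms] by (simp add: closure_of_openin_Int_superset dense)

lemma subset_closure_of_if_preimage_map_subset:
  assumes "openin Y U" "preimage_map X e U \<subseteq> preimage_map X e V"
  shows "U \<subseteq> Y closure_of V"
proof -
  have "U \<subseteq> Y closure_of (e ` preimage_map X e U)"
    unfolding closure_of_image_preimage_map[OF assms(1)]
    using assms(1) by (intro closure_of_subset openin_subset)
  also have "\<dots> \<subseteq> Y closure_of V"
    using assms(2) by (intro closure_of_mono) (auto simp: preimage_map_def)
  finally show ?thesis .
qed

lemma subset_if_preimage_map_subset:
  assumes "openin Y U" "regular_openin Y V" "preimage_map X e U \<subseteq> preimage_map X e V"
  shows "U \<subseteq> V"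
  using interior_of_maximal[OF subset_closure_of_if_preimage_map_subset[OF assms(1,3)] assms(1)]
    assms(2) by (simp add: regular_openin_def)

lemma closure_of_preimage_map:
  assumes "openin Y U"
  shows "X closure_of (preimage_map X e U) = preimage_map X e (Y closure_of U)"
proof (intro subset_antisym subsetI)
  fix x assume x: "x \<in> X closure_of (preimage_map X e U)"
  then have "e x \<in> Y closure_of U"
    using continuous_map_image_closure_subset[OF continuous]
      closure_of_image_preimage_map[OF assms] by blast
  then show "x \<in> preimage_map X e (Y closure_of U)"
    using x by (simp add: preimage_map_def in_closure_of)
next
  fix x assume x: "x \<in> preimage_map X e (Y closure_of U)"
  have "\<exists>y \<in> preimage_map X e U. y \<in> V" if "x \<in> V" "openin X V" for V
  proof -
    obtain W where W: "openin Y W" "preimage_map X e W = V"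
      using openin_eq_preimage_map[OF \<open>openin X V\<close>] .
    then have "W \<inter> U \<noteq> {}"
      using x \<open>x \<in> V\<close> by (auto simp: preimage_map_def in_closure_of)
    then have "preimage_map X e (W \<inter> U) \<noteq> {}"
      using assms W by (intro preimage_map_nonempty openin_Int)
    then show ?thesis
      using W(2) by (auto simp: preimage_map_def)
  qed
  then show "x \<in> X closure_of (preimage_map X e U)"
    using x unfolding in_closure_of by (auto simp: preimage_map_def)
qed

lemma interior_of_closure_of_preimage_map:
  assumes "openin Y U"
  shows "X interior_of (X closure_of (preimage_map X e U)) =
    preimage_map X e (Y interior_of (Y closure_of U))"
  unfolding closure_of_preimage_map[OF assms]
proof (rule subset_antisym)
  obtain V where V: "openin Y V"
      "preimage_map X e V = X interior_of (preimage_map X e (Y closure_of U))"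
    using openin_eq_preimage_map[OF openin_interior_of] .
  then have "preimage_map X e V \<subseteq> preimage_map X e (Y closure_of U)"
    by (simp add: interior_of_subset)
  then have "V \<subseteq> Y closure_of U"
    using subset_closure_of_if_preimage_map_subset[OF V(1)] closure_of_closure_of by metis
  then have "V \<subseteq> Y interior_of (Y closure_of U)"
    using V(1) by (rule interior_of_maximal)
  then show "X interior_of (preimage_map X e (Y closure_of U)) \<subseteq>
      preimage_map X e (Y interior_of (Y closure_of U))"
    unfolding V(2)[symmetric] by (rule preimage_map_mono)
  show "preimage_map X e (Y interior_of (Y closure_of U)) \<subseteq>
      X interior_of (preimage_map X e (Y closure_of U))"
    by (intro interior_of_maximal preimage_map_mono interior_of_subset openin_preimage_map) simp
qed

lemma image_preimage_map_regular_openin: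
  "preimage_map X e ` {U. regular_openin Y U} = {V. regular_openin X V}"
proof (intro subset_antisym subsetI)
  fix V assume "V \<in> preimage_map X e ` {U. regular_openin Y U}"
  then show "V \<in> {V. regular_openin X V}"
    using interior_of_closure_of_preimage_map[OF regular_openin_openin]
    by (auto simp: regular_openin_def)
next
  fix V assume V: "V \<in> {V. regular_openin X V}"
  then obtain U where U: "openin Y U" "preimage_map X e U = V"
    using openin_eq_preimage_map regular_openin_openin by blast
  then have "V = preimage_map X e (Y interior_of (Y closure_of U))"
    using V interior_of_closure_of_preimage_map[OF U(1)] by (simp add: regular_openin_def)
  then show "V \<in> preimage_map X e ` {U. regular_openin Y U}"
    by simp
qed

lemma closure_of_subset_iff_disjnt_closures:
  assumes U: "openin Y U" and V: "regular_openin Y V"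
  shows "Y closure_of U \<subseteq> V \<longleftrightarrow> disjnt (Y closure_of (e ` preimage_map X e U))
    (Y closure_of (e ` (topspace X - preimage_map X e V)))"
proof -
  let ?C = "Y closure_of (e ` (topspace X - preimage_map X e V))"
  have "V \<inter> e ` (topspace X - preimage_map X e V) = {}"
    by (auto simp: preimage_map_def)
  then have "V \<inter> ?C = {}"
    using openin_Int_closure_of_eq_empty[OF regular_openin_openin[OF V]] by blast
  moreover have "topspace Y - ?C \<subseteq> V"
  proof (rule subset_if_preimage_map_subset[OF openin_diff V])
    have "e ` (topspace X - preimage_map X e V) \<subseteq> ?C"
      using continuous_map_image_subset_topspace[OF continuous] by (intro closure_of_subset) blast
    then show "preimage_map X e (topspace Y - ?C) \<subseteq> preimage_map X e V"
      by (auto simp: preimage_map_def)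
  qed simp_all
  ultimately show ?thesis
    unfolding closure_of_image_preimage_map[OF U] disjnt_def
    using closure_of_subset_topspace[of Y U] by blast
qed

theorem induced_prox_iff:
  "induced_prox X Y e S T \<longleftrightarrow>
    regular_openin X S \<and> regular_openin X T \<and>
    disjnt (Y closure_of (e ` S)) (Y closure_of (e ` (topspace X - T)))"
proof -
  let ?disjoint = "disjnt (Y closure_of (e ` S)) (Y closure_of (e ` (topspace X - T)))"
  have "induced_prox X Y e S T \<longleftrightarrow>
      (\<exists>U V. regular_openin Y U \<and> regular_openin Y V \<and> S = preimage_map X e U \<and>
        T = preimage_map X e V \<and> Y closure_of U \<subseteq> V)"
    by (auto simp: image_prox_def)
  also have "\<dots> \<longleftrightarrow>
      (\<exists>U V. regular_openin Y U \<and> regular_openin Y V \<and> S = preimage_map X e U \<and>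
        T = preimage_map X e V \<and> ?disjoint)"
    using closure_of_subset_iff_disjnt_closures[OF regular_openin_openin] by metis
  also have "\<dots> \<longleftrightarrow> S \<in> preimage_map X e ` {U. regular_openin Y U} \<and>
      T \<in> preimage_map X e ` {U. regular_openin Y U} \<and> ?disjoint"
    by blast
  finally show ?thesis
    unfolding image_preimage_map_regular_openin by simp
qed

end

lemma compactification_imp_dense_embedding: "compactification X Y e \<Longrightarrow> dense_embedding X Y e"
  by (simp add: compactification_def dense_embedding_def)

lemma compatible_compactifications:
  assumes "compactification X Y e" "compactification X Z s"
  shows "compatible (regular_open_algebra Y) (preimage_map X e)
    (regular_open_algebra Z) (preimage_map X s)"
  using assms[THEN compactification_imp_dense_embedding]
  by (simp add: compatible_def dense_embedding.image_preimage_map_regular_openin)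

lemma induced_prox_le_if_compactification_le:
  assumes compactifications: "compactification X Y e" "compactification X Z s"
    and le: "compactification_le X Z s Y e"
  shows "induced_prox X Z s \<le> induced_prox X Y e"
proof (intro predicate2I)
  note iff = compactifications[THEN compactification_imp_dense_embedding,
      THEN dense_embedding.induced_prox_iff]
  obtain g where g: "continuous_map Y Z g" "\<And>x. x \<in> topspace X \<Longrightarrow> g (e x) = s x"
    using le unfolding compactification_le_def by blast
  fix S T assume "induced_prox X Z s S T"
  then have ST: "regular_openin X S" "regular_openin X T"
    and "disjnt (Z closure_of (s ` S)) (Z closure_of (s ` (topspace X - T)))"
    by (simp_all add: iff)
  moreover have "g ` e ` S = s ` S" "g ` e ` (topspace X - T) = s ` (topspace X - T)"
    using g(2) regular_openin_subset[OF ST(1)] by (auto simp: image_comp intro!: image_cong)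
  ultimately show "induced_prox X Y e S T"
    using disjnt_closures_of_if_images[OF g(1), of "e ` S" "e ` (topspace X - T)"]
    by (simp add: iff)
qed


section \<open>Extension of continuous maps from a dense subspace\<close>

context dense_embedding
begin

lemma cluster_point_exists:
  assumes f: "f \<in> topspace X \<rightarrow> topspace Z" and Z: "compact_space Z" and y: "y \<in> topspace Y"
  shows "\<exists>z \<in> topspace Z. \<forall>N. openin Y N \<and> y \<in> N \<longrightarrow> z \<in> Z closure_of (f ` preimage_map X e N)"
proof (rule ccontr)
  assume "\<not> ?thesis"
  then have "\<forall>z \<in> topspace Z. \<exists>N W. openin Y N \<and> y \<in> N \<and> openin Z W \<and> z \<in> W \<and>
      disjnt W (f ` preimage_map X e N)"
    unfolding in_closure_of disjnt_iff by metis
  then obtain N W where NW: "\<And>z. z \<in> topspace Z \<Longrightarrow> openin Y (N z) \<and> y \<in> N z \<and> openin Z (W z) \<and>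
      z \<in> W z \<and> disjnt (W z) (f ` preimage_map X e (N z))"
    by metis
  then have "(\<forall>V \<in> W ` topspace Z. openin Z V) \<and> topspace Z \<subseteq> \<Union>(W ` topspace Z)"
    by blast
  then obtain \<V> where "finite \<V>" "\<V> \<subseteq> W ` topspace Z" "topspace Z \<subseteq> \<Union>\<V>"
    using Z unfolding compact_space_alt by metis
  then obtain I where I: "finite I" "I \<subseteq> topspace Z" "topspace Z \<subseteq> \<Union>(W ` I)"
    using finite_subset_image by metis
  define M where "M = topspace Y \<inter> \<Inter>(N ` I)"
  have "openin Y M"
    unfolding M_def using I NW by (intro openin_Int_Inter) auto
  moreover have "y \<in> M"
    using I y NW by (auto simp: M_def)
  ultimately obtain x where x: "x \<in> topspace X" "e x \<in> M"
    using preimage_map_nonempty[of M] by (auto simp: preimage_map_def)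
  then obtain z where "z \<in> I" "f x \<in> W z"
    using f I(3) by blast
  then show False
    using NW[of z] I(2) x by (auto simp: M_def disjnt_iff preimage_map_def)
qed

lemma in_closure_of_image_preimage_map:
  assumes "x \<in> topspace X" "f x \<in> A"
  shows "e x \<in> Y closure_of (e ` preimage_map X f A)"
  using assms continuous_map_image_subset_topspace[OF continuous]
  by (intro subsetD[OF closure_of_subset]) (auto simp: preimage_map_def)

lemma cluster_point_imp_in_closure_of:
  assumes z: "\<And>N. \<lbrakk>openin Y N; y \<in> N\<rbrakk> \<Longrightarrow> z \<in> Z closure_of (f ` preimage_map X e N)"
    and V: "openin Z V" "z \<in> V" and y: "y \<in> topspace Y"
  shows "y \<in> Y closure_of (e ` preimage_map X f V)"
  unfolding in_closure_of
proof (intro conjI allI impI y)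
  fix N assume "y \<in> N \<and> openin Y N"
  then obtain x where "x \<in> preimage_map X e N" "f x \<in> V"
    using z[of N] V by (auto simp: in_closure_of)
  then show "\<exists>w. w \<in> e ` preimage_map X f V \<and> w \<in> N"
    by (auto simp: preimage_map_def)
qed

lemma limit_exists_if_disjnt_closures:
  assumes f: "f \<in> topspace X \<rightarrow> topspace Z" and Z: "compact_space Z" "regular_space Z"
    and separated: "\<And>A B. \<lbrakk>closedin Z A; closedin Z B; disjnt A B\<rbrakk> \<Longrightarrow>
      disjnt (Y closure_of (e ` preimage_map X f A)) (Y closure_of (e ` preimage_map X f B))"
    and y: "y \<in> topspace Y"
  shows "\<exists>z \<in> topspace Z. \<forall>W. openin Z W \<and> z \<in> W \<longrightarrow>
    (\<exists>N. openin Y N \<and> y \<in> N \<and> f ` preimage_map X e N \<subseteq> W)"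
proof -
  let ?K = "\<lambda>A. Y closure_of (e ` preimage_map X f A)"
  obtain z where z: "z \<in> topspace Z"
      "\<And>N. \<lbrakk>openin Y N; y \<in> N\<rbrakk> \<Longrightarrow> z \<in> Z closure_of (f ` preimage_map X e N)"
    using cluster_point_exists[OF f Z(1) y] by blast
  have "\<exists>N. openin Y N \<and> y \<in> N \<and> f ` preimage_map X e N \<subseteq> W" if W: "openin Z W" "z \<in> W" for W
  proof -
    obtain V where V: "regular_openin Z V" "z \<in> V" "Z closure_of V \<subseteq> W"
      using regular_open_neighbourhood[OF Z(2) W] .
    have "y \<in> ?K V"
      using z(2) regular_openin_openin[OF V(1)] V(2) y by (rule cluster_point_imp_in_closure_of)
    moreover have "?K V \<subseteq> ?K (Z closure_of V)"
      using regular_openin_subset_closure[OF V(1)]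
      by (intro closure_of_mono image_mono preimage_map_mono)
    moreover have "disjnt (?K (Z closure_of V)) (?K (topspace Z - W))"
      using V(3) W(1) by (intro separated) (auto simp: disjnt_def)
    ultimately have "y \<in> topspace Y - ?K (topspace Z - W)"
      using y by (auto simp: disjnt_iff)
    moreover have "f ` preimage_map X e (topspace Y - ?K (topspace Z - W)) \<subseteq> W"
      using f in_closure_of_image_preimage_map[of _ f "topspace Z - W"]
      by (auto simp: preimage_map_def)
    moreover have "openin Y (topspace Y - ?K (topspace Z - W))"
      by (intro openin_diff) simp_all
    ultimately show ?thesis
      by blast
  qed
  with z(1) show ?thesis
    by blast
qed

lemma limitin_comp_left_inverse:
  assumes inverse: "\<And>x. x \<in> topspace X \<Longrightarrow> k (e x) = x" and z: "z \<in> topspace Z"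
    and nbhd: "\<forall>W. openin Z W \<and> z \<in> W \<longrightarrow>
      (\<exists>N. openin Y N \<and> y \<in> N \<and> f ` preimage_map X e N \<subseteq> W)"
  shows "limitin Z (f \<circ> k) z (atin_within Y y (e ` topspace X))"
  unfolding limitin_def eventually_atin_within
proof (intro conjI allI impI disjI2 z)
  fix W assume "openin Z W \<and> z \<in> W"
  then obtain N where N: "openin Y N" "y \<in> N" "f ` preimage_map X e N \<subseteq> W"
    using nbhd by blast
  then have "\<forall>w \<in> N. w \<in> e ` topspace X \<and> w \<noteq> y \<longrightarrow> (f \<circ> k) w \<in> W"
    by (auto simp: preimage_map_def inverse)
  with N show "\<exists>N. openin Y N \<and> y \<in> N \<and>
      (\<forall>w \<in> N. w \<in> e ` topspace X \<and> w \<noteq> y \<longrightarrow> (f \<circ> k) w \<in> W)"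
    by blast
qed

theorem Taimanov_extension:
  assumes f: "continuous_map X Z f" and Z: "compact_space Z" "regular_space Z"
    and separated: "\<And>A B. \<lbrakk>closedin Z A; closedin Z B; disjnt A B\<rbrakk> \<Longrightarrow>
      disjnt (Y closure_of (e ` preimage_map X f A)) (Y closure_of (e ` preimage_map X f B))"
  obtains F where "continuous_map Y Z F" "\<And>x. x \<in> topspace X \<Longrightarrow> F (e x) = f x"
proof -
  obtain k where k: "homeomorphic_maps X (subtopology Y (e ` topspace X)) e k"
    using embedding unfolding embedding_map_def homeomorphic_map_maps by blast
  have inverse: "k (e x) = x" if "x \<in> topspace X" for x
    using k that by (simp add: homeomorphic_maps_def)
  have limit: "\<exists>z. limitin Z (f \<circ> k) z (atin_within Y y (e ` topspace X))"
    if y: "y \<in> topspace Y - e ` topspace X" for y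
  proof -
    obtain z where z: "z \<in> topspace Z"
        "\<forall>W. openin Z W \<and> z \<in> W \<longrightarrow> (\<exists>N. openin Y N \<and> y \<in> N \<and> f ` preimage_map X e N \<subseteq> W)"
      using limit_exists_if_disjnt_closures[OF continuous_map_funspace[OF f] Z separated
          DiffD1[OF y]] ..
    have "limitin Z (f \<circ> k) z (atin_within Y y (e ` topspace X))"
      using inverse z by (rule limitin_comp_left_inverse)
    then show ?thesis ..
  qed
  have "continuous_map (subtopology Y (e ` topspace X)) Z (f \<circ> k)"
    using k f continuous_map_compose unfolding homeomorphic_maps_def by blast
  moreover have "e ` topspace X \<subseteq> topspace Y" "topspace Y \<subseteq> Y closure_of (e ` topspace X)"
    using continuous_map_image_subset_topspace[OF continuous] dense by simp_all
  ultimately obtain F where "continuous_map (subtopology Y (topspace Y)) Z F"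
      "\<And>y. y \<in> e ` topspace X \<Longrightarrow> F y = (f \<circ> k) y"
    using continuous_map_extension_pointwise_alt[OF Z(2) _ _ _ limit] by blast
  then show thesis
    using that[of F] by (simp add: inverse)
qed

end

lemma normal_space_regular_openin_between:
  assumes "normal_space Z" "closedin Z A" "openin Z W" "A \<subseteq> W"
  obtains U where "regular_openin Z U" "A \<subseteq> U" "Z closure_of U \<subseteq> W"
proof -
  obtain V where V: "openin Z V" "A \<subseteq> V" "Z closure_of V \<subseteq> W"
    using assms unfolding normal_space_alt by metis
  have "regular_openin Z (Z interior_of (Z closure_of V))"
    by simp
  moreover have "A \<subseteq> Z interior_of (Z closure_of V)"
    using V(2) interior_closure_increasing[OF V(1)] by blast
  moreover have "Z closure_of (Z interior_of (Z closure_of V)) \<subseteq> W"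
    using V(3) closure_interior_closure[of Z V] by blast
  ultimately show thesis
    by (rule that)
qed

lemma induced_prox_separates_closedin:
  assumes Z: "compact_space Z" "Hausdorff_space Z"
    and A: "closedin Z A" and B: "closedin Z B" and AB: "disjnt A B"
  obtains S T where "induced_prox X Z s S T"
    "preimage_map X s A \<subseteq> S" "preimage_map X s B \<subseteq> topspace X - T"
proof -
  have normal: "normal_space Z"
    using Z compact_Hausdorff_or_regular_imp_normal_space by blast
  have "openin Z (topspace Z - B)" "A \<subseteq> topspace Z - B"
    using A B AB closedin_subset by (auto simp: disjnt_iff)
  then obtain V where V: "regular_openin Z V" "A \<subseteq> V" "Z closure_of V \<subseteq> topspace Z - B"
    using normal_space_regular_openin_between[OF normal A] by metis
  then obtain U where U: "regular_openin Z U" "A \<subseteq> U" "Z closure_of U \<subseteq> V"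
    using normal_space_regular_openin_between[OF normal A regular_openin_openin] by metis
  show thesis
  proof
    show "induced_prox X Z s (preimage_map X s U) (preimage_map X s V)"
      using U V by (auto simp: image_prox_def)
    show "preimage_map X s A \<subseteq> preimage_map X s U"
      using U(2) by (rule preimage_map_mono)
    show "preimage_map X s B \<subseteq> topspace X - preimage_map X s V"
      using V regular_openin_subset_closure[OF V(1)] by (auto simp: preimage_map_def)
  qed
qed

theorem compactification_le_iff_induced_prox_le:
  assumes Y: "compactification X Y e" and Z: "compactification X Z s"
  shows "compactification_le X Z s Y e \<longleftrightarrow> induced_prox X Z s \<le> induced_prox X Y e"
proof
  assume "compactification_le X Z s Y e"
  then show "induced_prox X Z s \<le> induced_prox X Y e"
    by (rule induced_prox_le_if_compactification_le[OF Y Z])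
next
  assume le: "induced_prox X Z s \<le> induced_prox X Y e"
  interpret Y: dense_embedding X Y e
    using Y by (rule compactification_imp_dense_embedding)
  interpret Z: dense_embedding X Z s
    using Z by (rule compactification_imp_dense_embedding)
  have compact: "compact_space Z" "Hausdorff_space Z"
    using Z by (simp_all add: compactification_def)
  have "disjnt (Y closure_of (e ` preimage_map X s A)) (Y closure_of (e ` preimage_map X s B))"
    if AB: "closedin Z A" "closedin Z B" "disjnt A B" for A B
  proof -
    obtain S T where ST: "induced_prox X Z s S T"
        "preimage_map X s A \<subseteq> S" "preimage_map X s B \<subseteq> topspace X - T"
      using induced_prox_separates_closedin[OF compact AB] .
    then have "disjnt (Y closure_of (e ` S)) (Y closure_of (e ` (topspace X - T)))"
      using le by (auto simp: Y.induced_prox_iff)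
    then show ?thesis
      by (meson ST(2,3) closure_of_mono disjnt_subset1 disjnt_subset2 image_mono)
  qed
  then obtain F where "continuous_map Y Z F" "\<And>x. x \<in> topspace X \<Longrightarrow> F (e x) = s x"
    using Y.Taimanov_extension[OF Z.continuous compact(1)
        compact_Hausdorff_imp_regular_space[OF compact]] by metis
  then show "compactification_le X Z s Y e"
    unfolding compactification_le_def by blast
qed


section \<open>Separation by continuous functions\<close>

definition completely_separated :: "'a topology \<Rightarrow> 'a set \<Rightarrow> 'a set \<Rightarrow> bool" where
  "completely_separated X S T \<longleftrightarrow>
    (\<exists>f. continuous_map X (top_of_set {0..1::real}) f \<and> f ` S \<subseteq> {0} \<and> f ` T \<subseteq> {1})"

locale open_scale =
  fixes X :: "'a topology" and D :: "real set" and G :: "real \<Rightarrow> 'a set"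
  assumes subset_unit: "D \<subseteq> {0..1}"
    and order_dense: "\<And>c d. \<lbrakk>0 \<le> c; c < d; d \<le> 1\<rbrakk> \<Longrightarrow> \<exists>r \<in> D. c < r \<and> r < d"
    and openin_G: "\<And>r. r \<in> D \<Longrightarrow> openin X (G r)"
    and closure_of_G_subset: "\<And>q r. \<lbrakk>q \<in> D; r \<in> D; q < r\<rbrakk> \<Longrightarrow> X closure_of (G q) \<subseteq> G r"
begin

text \<open>The bound \<open>1\<close> is inserted because \<open>Inf {}\<close> is unspecified.\<close>

definition level :: "'a \<Rightarrow> real" where
  "level x = Inf (insert 1 {r \<in> D. x \<in> G r})"

lemma bdd_below_levels: "bdd_below (insert 1 {r \<in> D. x \<in> G r})"
  using subset_unit by (intro bdd_belowI[of _ 0]) auto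

lemma level_nonneg: "0 \<le> level x"
  unfolding level_def using subset_unit by (intro cInf_greatest) auto

lemma level_le_1: "level x \<le> 1"
  unfolding level_def by (intro cInf_lower bdd_below_levels) simp

lemma level_le: "\<lbrakk>r \<in> D; x \<in> G r\<rbrakk> \<Longrightarrow> level x \<le> r"
  unfolding level_def by (intro cInf_lower bdd_below_levels) simp

lemma G_mono:
  assumes "q \<in> D" "r \<in> D" "q \<le> r"
  shows "G q \<subseteq> G r"
  using closure_of_G_subset[OF assms(1,2)]
    closure_of_subset[OF openin_subset[OF openin_G[OF assms(1)]]] assms(3) by (cases "q = r") auto

lemma level_ge:
  assumes "r \<in> D" "x \<notin> G r"
  shows "r \<le> level x"
  unfolding level_def
proof (rule cInf_greatest)
  fix q assume "q \<in> insert 1 {q \<in> D. x \<in> G q}"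
  then show "r \<le> q"
    using assms G_mono[of q r] subset_unit by (cases "q \<le> r") auto
qed simp

lemma level_less_iff: "level x < a \<longleftrightarrow> 1 < a \<or> (\<exists>r \<in> D. r < a \<and> x \<in> G r)"
  unfolding level_def by (subst cInf_less_iff[OF _ bdd_below_levels]) auto

lemma less_level_iff:
  assumes x: "x \<in> topspace X"
  shows "a < level x \<longleftrightarrow> a < 0 \<or> (\<exists>r \<in> D. a < r \<and> x \<notin> X closure_of (G r))"
proof
  assume a_less: "a < level x"
  show "a < 0 \<or> (\<exists>r \<in> D. a < r \<and> x \<notin> X closure_of (G r))"
  proof (cases "a < 0")
    case False
    then obtain r where r: "r \<in> D" "a < r" "r < level x"
      using a_less order_dense[of a "level x"] level_le_1[of x] by auto
    moreover have "r \<le> 1"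
      using r(1) subset_unit by auto
    ultimately obtain q where q: "q \<in> D" "a < q" "q < r"
      using False order_dense[of a r] by auto
    have "x \<notin> X closure_of (G q)"
      using closure_of_G_subset[OF q(1) r(1) q(3)] level_le[OF r(1), of x] r(3) by auto
    with q show ?thesis
      by blast
  qed simp
next
  assume "a < 0 \<or> (\<exists>r \<in> D. a < r \<and> x \<notin> X closure_of (G r))"
  then show "a < level x"
  proof
    assume "\<exists>r \<in> D. a < r \<and> x \<notin> X closure_of (G r)"
    then obtain r where r: "r \<in> D" "a < r" "x \<notin> X closure_of (G r)"
      by blast
    then have "x \<notin> G r"
      using closure_of_subset[OF openin_subset[OF openin_G[OF r(1)]]] by blast
    then show ?thesis
      using level_ge[OF r(1), of x] r(2) by simp
  qed (use level_nonneg[of x] in simp)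
qed

lemma continuous_level: "continuous_map X (top_of_set {0..1}) level"
  unfolding continuous_map_upper_lower_semicontinuous_lt_gen
proof (intro conjI ballI allI)
  fix a
  have "{x \<in> topspace X. level x < a} =
      (if 1 < a then topspace X else (\<Union>r \<in> {r \<in> D. r < a}. G r))"
    using openin_subset[OF openin_G] by (auto simp: level_less_iff)
  then show "openin X {x \<in> topspace X. level x < a}"
    using openin_G by auto
  have "{x \<in> topspace X. a < level x} =
      (if a < 0 then topspace X else (\<Union>r \<in> {r \<in> D. a < r}. topspace X - X closure_of (G r)))"
    by (auto simp: less_level_iff)
  moreover have "openin X (\<Union>r \<in> {r \<in> D. a < r}. topspace X - X closure_of (G r))"
    by (intro openin_clauses(3)) auto
  ultimately show "openin X {x \<in> topspace X. a < level x}"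
    by simp
qed (use level_nonneg level_le_1 in auto)

lemma completely_separated_ends:
  assumes "0 \<in> D" "1 \<in> D"
  shows "completely_separated X (G 0) (topspace X - G 1)"
proof -
  have "level ` G 0 \<subseteq> {0}"
    using level_le[OF assms(1)] level_nonneg by (auto intro: order_antisym)
  moreover have "level ` (topspace X - G 1) \<subseteq> {1}"
    using level_ge[OF assms(2)] level_le_1 by (auto intro: order_antisym)
  ultimately show ?thesis
    using continuous_level unfolding completely_separated_def by blast
qed

end

lemma dyadics_order_dense:
  fixes c d :: real
  assumes "0 \<le> c" "c < d" "d \<le> 1"
  shows "\<exists>r \<in> dyadics \<inter> {0..1}. c < r \<and> r < d"
proof -
  have "0 < d - c" "(1::real) < 2"
    using assms by simp_all
  then obtain n q r where
    "of_nat q / 2 ^ n \<le> c" "c < of_nat r / 2 ^ n" "\<bar>real q / 2 ^ n - real r / 2 ^ n\<bar> < d - c"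
    using assms(1) by (rule padic_rational_approximation_straddle_pos_le)
  then have "c < real r / 2 ^ n" "real r / 2 ^ n < d"
    by linarith+
  moreover from this have "real r / 2 ^ n \<in> {0..1}"
    using assms unfolding atLeastAtMost_iff by linarith
  moreover have "real r / 2 ^ n \<in> dyadics"
    by (auto simp: dyadics_def)
  ultimately show ?thesis
    by blast
qed

lemma completely_separated_if_interpolating:
  assumes "R S T"
    and interpolation: "\<And>U V. R U V \<Longrightarrow> \<exists>W. R U W \<and> R W V"
    and trans: "\<And>U V W. \<lbrakk>R U V; R V W\<rbrakk> \<Longrightarrow> R U W"
    and separated: "\<And>U V. R U V \<Longrightarrow> openin X U \<and> openin X V \<and> X closure_of U \<subseteq> V"
  shows "completely_separated X S (topspace X - T)"
proof -
  let ?D = "dyadics \<inter> {0..1::real}"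
  have "\<exists>G :: real \<Rightarrow> 'a set. G 0 = S \<and> G 1 = T \<and> (\<forall>q \<in> ?D. \<forall>r \<in> ?D. q < r \<longrightarrow> R (G q) (G r))"
    by (rule recursion_on_dyadic_fractions) (fact assms(1) interpolation trans)+
  then obtain G :: "real \<Rightarrow> 'a set" where G01: "G 0 = S" "G 1 = T"
    and G: "\<And>q r. \<lbrakk>q \<in> ?D; r \<in> ?D; q < r\<rbrakk> \<Longrightarrow> R (G q) (G r)"
    by blast
  have D01: "0 \<in> ?D" "1 \<in> ?D"
    by (force simp: dyadics_def)+
  interpret open_scale X ?D G
  proof
    show "openin X (G r)" if "r \<in> ?D" for r
      using separated[OF G[OF that D01(2)]] separated[OF assms(1)] G01(2) that
      by (cases "r = 1") auto
    show "X closure_of (G q) \<subseteq> G r" if "q \<in> ?D" "r \<in> ?D" "q < r" for q r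
      using separated[OF G[OF that]] by blast
  qed (simp_all add: dyadics_order_dense)
  show ?thesis
    using completely_separated_ends[OF D01] by (simp add: G01)
qed


section \<open>The Stone--Cech compactification\<close>

lemma embedding_map_if_compose:
  assumes f: "continuous_map X Y f" and g: "continuous_map Y Z g"
    and comp: "embedding_map X Z (g \<circ> f)"
  shows "embedding_map X Y f"
proof -
  obtain k where k: "homeomorphic_maps X (subtopology Z ((g \<circ> f) ` topspace X)) (g \<circ> f) k"
    using comp unfolding embedding_map_def homeomorphic_map_maps by blast
  have "homeomorphic_maps X (subtopology Y (f ` topspace X)) f (k \<circ> g)"
    unfolding homeomorphic_maps_def
  proof (intro conjI ballI)
    show "continuous_map X (subtopology Y (f ` topspace X)) f"
      using f by (simp add: continuous_map_in_subtopology)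
    have "continuous_map (subtopology Y (f ` topspace X)) (subtopology Z ((g \<circ> f) ` topspace X)) g"
      using g by (auto simp: continuous_map_in_subtopology continuous_map_from_subtopology)
    then show "continuous_map (subtopology Y (f ` topspace X)) X (k \<circ> g)"
      using k continuous_map_compose unfolding homeomorphic_maps_def by blast
  qed (use k in \<open>auto simp: homeomorphic_maps_def\<close>)
  then show ?thesis
    unfolding embedding_map_def homeomorphic_map_maps by blast
qed

lemma compactification_closure_of_image:
  assumes K: "compact_space K" "Hausdorff_space K" and p: "embedding_map X K p"
  shows "compactification X (subtopology K (K closure_of (p ` topspace X))) p"
proof -
  let ?C = "K closure_of (p ` topspace X)"
  have sub: "p ` topspace X \<subseteq> ?C"
    using embedding_map_image[OF p] by (rule closure_of_subset)
  have hom: "X homeomorphic_space subtopology K (p ` topspace X)"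
    using p by (rule embedding_map_imp_homeomorphic_space)
  have "completely_regular_space K"
    using K compact_Hausdorff_or_regular_imp_normal_space normal_imp_completely_regular_space
    by blast
  then have "completely_regular_space X" "Hausdorff_space X"
    using hom K(2) homeomorphic_completely_regular_space homeomorphic_Hausdorff_space
      completely_regular_space_subtopology Hausdorff_space_subtopology by metis+
  moreover have "compact_space (subtopology K ?C)"
    using K(1) by (intro compact_space_subtopology closedin_compact_space) simp_all
  moreover have "subtopology K ?C closure_of (p ` topspace X) = topspace (subtopology K ?C)"
    using sub closure_of_subset_topspace[of K "p ` topspace X"]
    by (simp add: closure_of_subtopology Int_absorb1)
  ultimately show ?thesis
    using p sub K(2)
    by (simp add: compactification_def embedding_map_in_subtopology Hausdorff_space_subtopology)
qed

lemma stone_cech_extension: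
  assumes s: "stone_cech X Z s" and K: "compact_space K" "Hausdorff_space K"
    and f: "continuous_map X K f"
  obtains F where "continuous_map Z K F" "\<And>x. x \<in> topspace X \<Longrightarrow> F (s x) = f x"
proof -
  have comp: "compactification X Z s"
    using s by (simp add: stone_cech_def)
  then interpret dense_embedding X Z s
    by (rule compactification_imp_dense_embedding)
  let ?p = "\<lambda>x. (s x, f x)" and ?P = "prod_topology Z K"
  have "continuous_map X ?P ?p"
    using continuous f by (rule continuous_map_pairedI)
  moreover have "embedding_map X Z (fst \<circ> ?p)"
    using embedding by (simp add: comp_def)
  ultimately have "embedding_map X ?P ?p"
    by (rule embedding_map_if_compose[OF _ continuous_map_fst])
  moreover have "compact_space ?P" "Hausdorff_space ?P"
    using comp K
    by (simp_all add: compactification_def compact_space_prod_topology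
        Hausdorff_space_prod_topology)
  ultimately have "compactification X (subtopology ?P (?P closure_of (?p ` topspace X))) ?p"
    by (intro compactification_closure_of_image)
  from stone_cech_largest[OF s this] obtain g where
    g: "continuous_map Z ?P g" "\<And>x. x \<in> topspace X \<Longrightarrow> g (s x) = (s x, f x)"
    unfolding compactification_le_def by (auto simp: continuous_map_in_subtopology)
  show thesis
  proof
    show "continuous_map Z K (snd \<circ> g)"
      using g(1) continuous_map_snd by (rule continuous_map_compose)
  qed (simp add: g(2))
qed

lemma stone_cech_disjnt_closures:
  assumes s: "stone_cech X Z s" and ST: "completely_separated X S T"
    and sub: "S \<subseteq> topspace X" "T \<subseteq> topspace X"
  shows "disjnt (Z closure_of (s ` S)) (Z closure_of (s ` T))"
proof -
  let ?I = "top_of_set {0..1::real}"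
  obtain f where f: "continuous_map X ?I f" "f ` S \<subseteq> {0}" "f ` T \<subseteq> {1}"
    using ST unfolding completely_separated_def by blast
  obtain F where F: "continuous_map Z ?I F" "\<And>x. x \<in> topspace X \<Longrightarrow> F (s x) = f x"
    using stone_cech_extension[OF s _ _ f(1)]
    by (metis compact_Icc compact_space_subtopology compactin_euclidean_iff
        Hausdorff_space_euclidean Hausdorff_space_subtopology)
  have "F ` s ` S \<subseteq> {0}" "F ` s ` T \<subseteq> {1}"
    using F(2) f(2,3) sub by (auto simp: subset_iff)
  then have "?I closure_of (F ` s ` S) \<subseteq> {0}" "?I closure_of (F ` s ` T) \<subseteq> {1}"
    by (intro closure_of_minimal; simp add: closedin_closed_subset)+
  then have "disjnt (?I closure_of (F ` s ` S)) (?I closure_of (F ` s ` T))"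
    by (auto simp: disjnt_iff)
  then show ?thesis
    by (rule disjnt_closures_of_if_images[OF F(1)])
qed

lemma powerset_morphism_closure_of_subset:
  assumes \<gamma>: "de_vries_morphism C (powerset_algebra X) \<gamma>"
    and open_images: "\<And>c. c \<in> carrier C \<Longrightarrow> openin X (\<gamma> c)"
    and prox_cd: "c \<in> carrier C" "d \<in> carrier C" "c \<lless>\<^bsub>C\<^esub> d"
  shows "X closure_of (\<gamma> c) \<subseteq> \<gamma> d"
proof -
  interpret de_vries_morphism C "powerset_algebra X" \<gamma>
    by (rule \<gamma>)
  have complement_closed: "\<sim>\<^bsub>C\<^esub> c \<in> carrier C"
    using prox_cd(1) by (rule source.complement)
  have sub: "\<gamma> c \<subseteq> topspace X" "\<gamma> (\<sim>\<^bsub>C\<^esub> c) \<subseteq> topspace X"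
    using open_images prox_cd(1) complement_closed by (auto dest: openin_subset)
  have "\<gamma> c \<inter> \<gamma> (\<sim>\<^bsub>C\<^esub> c) = {}"
    using meet_image_complement[OF prox_cd(1)] sub by (simp add: powerset_ops)
  then have "X closure_of (\<gamma> c) \<subseteq> topspace X - \<gamma> (\<sim>\<^bsub>C\<^esub> c)"
    using sub(1) open_images[OF complement_closed] by (intro closure_of_minimal) auto
  also have "\<dots> \<subseteq> \<gamma> d"
    using M3[OF prox_cd] sub(2) by (simp add: powerset_complement)
  finally show ?thesis .
qed

lemma completely_separated_if_image_prox:
  assumes \<gamma>: "de_vries_extension C (powerset_algebra X) \<gamma>"
    and open_images: "\<And>c. c \<in> carrier C \<Longrightarrow> openin X (\<gamma> c)"
    and ST: "image_prox C \<gamma> S T"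
  shows "completely_separated X S (topspace X - T)"
proof -
  interpret de_vries_extension C "powerset_algebra X" \<gamma>
    by (rule \<gamma>)
  have separated: "openin X U \<and> openin X V \<and> X closure_of U \<subseteq> V" if "image_prox C \<gamma> U V" for U V
    using that open_images
      powerset_morphism_closure_of_subset[OF de_vries_morphism_axioms open_images]
    by (auto simp: image_prox_def)
  show ?thesis
    by (rule completely_separated_if_interpolating[of "image_prox C \<gamma>"])
      (fact ST image_prox_interpolation image_prox_trans separated)+
qed

theorem stone_cech_induced_prox_greatest:
  assumes s: "stone_cech X Z s" and \<gamma>: "de_vries_extension C (powerset_algebra X) \<gamma>"
    and img: "\<gamma> ` carrier C = {V. regular_openin X V}"
  shows "image_prox C \<gamma> \<le> induced_prox X Z s"
proof (intro predicate2I)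
  interpret dense_embedding X Z s
    using s by (simp add: stone_cech_def compactification_imp_dense_embedding)
  fix S T assume ST: "image_prox C \<gamma> S T"
  then have reg: "regular_openin X S" "regular_openin X T"
    using img by (auto simp: image_prox_def)
  have "openin X (\<gamma> c)" if "c \<in> carrier C" for c
    using that img by (auto intro: regular_openin_openin)
  then have "completely_separated X S (topspace X - T)"
    using completely_separated_if_image_prox[OF \<gamma> _ ST] by blast
  then have "disjnt (Z closure_of (s ` S)) (Z closure_of (s ` (topspace X - T)))"
    using regular_openin_subset[OF reg(1)] by (intro stone_cech_disjnt_closures[OF s]) auto
  then show "induced_prox X Z s S T"
    using reg by (simp add: induced_prox_iff)
qed

lemma maximal_extension_iff_stone_cech_le:
  fixes X :: "'x topology" and Y :: "'y topology" and Z :: "'z topology"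
  assumes Y: "compactification X Y e" and s: "stone_cech X Z s"
  shows "maximal_extension (regular_open_algebra Y) (powerset_algebra X) (preimage_map X e) \<longleftrightarrow>
    compactification_le X Z s Y e"
proof
  have Z: "compactification X Z s"
    using s by (simp add: stone_cech_def)
  interpret dense_embedding X Y e
    using Y by (rule compactification_imp_dense_embedding)
  note le_iff = compactification_le_iff_induced_prox_le[OF Y Z]
  show "compactification_le X Z s Y e"
    if "maximal_extension (regular_open_algebra Y) (powerset_algebra X) (preimage_map X e)"
    unfolding le_iff
    using that de_vries_extension_compactification[OF Z] compatible_compactifications[OF Y Z]
    by (rule maximal_extension_imp_image_prox_le)
  assume above: "compactification_le X Z s Y e"
  show "maximal_extension (regular_open_algebra Y) (powerset_algebra X) (preimage_map X e)"
  proof (rule maximal_extensionI[OF de_vries_extension_compactification[OF Y]])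
    fix C :: "'y set proximity_order" and \<gamma>
    assume C: "de_vries_extension C (powerset_algebra X) \<gamma>"
      "compatible (regular_open_algebra Y) (preimage_map X e) C \<gamma>"
    then have "\<gamma> ` carrier C = {V. regular_openin X V}"
      by (simp add: compatible_def image_preimage_map_regular_openin)
    then have "image_prox C \<gamma> \<le> induced_prox X Z s"
      by (rule stone_cech_induced_prox_greatest[OF s C(1)])
    also have "\<dots> \<le> induced_prox X Y e"
      using above by (simp only: le_iff)
    finally show "image_prox C \<gamma> \<le> induced_prox X Y e" .
  qed
qed


section \<open>Equivalence and isomorphism of compactifications\<close>

lemma (in dense_embedding) continuous_map_unique:
  assumes f: "continuous_map Y Z f" and g: "continuous_map Y Z g" and Z: "Hausdorff_space Z"
    and eq: "\<And>x. x \<in> topspace X \<Longrightarrow> f (e x) = g (e x)" and y: "y \<in> topspace Y"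
  shows "f y = g y"
  using forall_in_closure_of_eq[OF _ Z f g, of y "e ` topspace X"] y eq dense
  by auto

lemma compactification_equiv_imp_isomorphic:
  assumes Y: "compactification X Y e" and Z: "compactification X Z s"
    and equiv: "compactification_equiv X Y e Z s"
  shows "comp_isomorphic X Y e X Z s"
proof -
  obtain f g where f: "continuous_map Z Y f" "\<And>x. x \<in> topspace X \<Longrightarrow> f (s x) = e x"
    and g: "continuous_map Y Z g" "\<And>x. x \<in> topspace X \<Longrightarrow> g (e x) = s x"
    using equiv unfolding compactification_equiv_def compactification_le_def by metis
  interpret Y: dense_embedding X Y e
    using Y by (rule compactification_imp_dense_embedding)
  interpret Z: dense_embedding X Z s
    using Z by (rule compactification_imp_dense_embedding)
  have haus: "Hausdorff_space Y" "Hausdorff_space Z"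
    using Y Z by (simp_all add: compactification_def)
  have "(f \<circ> g) y = id y" if "y \<in> topspace Y" for y
    using continuous_map_compose[OF g(1) f(1)] continuous_map_id haus(1)
    by (rule Y.continuous_map_unique) (simp_all add: f g that)
  moreover have "(g \<circ> f) z = id z" if "z \<in> topspace Z" for z
    using continuous_map_compose[OF f(1) g(1)] continuous_map_id haus(2)
    by (rule Z.continuous_map_unique) (simp_all add: f g that)
  ultimately have "comp_is_identity X Y (comp_compose (id, f) (id, g))"
    "comp_is_identity X Z (comp_compose (id, g) (id, f))"
    by (simp_all add: comp_is_identity_def comp_compose_def)
  moreover have "comp_morphism X Y e X Z s (id, g)" "comp_morphism X Z s X Y e (id, f)"
    using f g by (simp_all add: comp_morphism_def)
  ultimately show ?thesis
    unfolding comp_isomorphic_def by blast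
qed

lemma compactification_comp_homeomorphic_map:
  assumes h: "homeomorphic_map X' X h" and Z: "compactification X Z s"
  shows "compactification X' Z (s \<circ> h)"
proof -
  have "X' homeomorphic_space X"
    using h by (rule homeomorphic_map_imp_homeomorphic_space)
  then have "completely_regular_space X'" "Hausdorff_space X'"
    using Z homeomorphic_completely_regular_space homeomorphic_Hausdorff_space
    unfolding compactification_def by blast+
  moreover have img: "h ` topspace X' = topspace X"
    using h by (rule homeomorphic_imp_surjective_map)
  moreover have "embedding_map X' Z (s \<circ> h)"
    using h img Z
    by (intro embedding_map_compose[of X' X]) (simp_all add: embedding_map_def compactification_def)
  moreover have "(s \<circ> h) ` topspace X' = s ` topspace X"
    using img by (simp only: image_comp[symmetric])
  ultimately show ?thesis
    using Z by (simp only: compactification_def)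
qed

lemma isomorphic_stone_cech_imp_equiv:
  assumes Y: "compactification X Y e" and s: "stone_cech X Z s"
    and iso: "comp_isomorphic X Y e X Z s"
  shows "compactification_equiv X Y e Z s"
proof -
  have Z: "compactification X Z s"
    using s by (simp add: stone_cech_def)
  obtain f f' g where f: "homeomorphic_maps X X f f'"
    and g: "continuous_map Y Z g" "\<And>x. x \<in> topspace X \<Longrightarrow> g (e x) = s (f x)"
    using iso by (auto simp: comp_isomorphic_def comp_morphism_def comp_is_identity_def
        comp_compose_def homeomorphic_maps_def)
  then have "homeomorphic_map X X f'"
    using homeomorphic_map_maps homeomorphic_maps_sym by blast
  then have "compactification X Z (s \<circ> f')"
    using Z by (rule compactification_comp_homeomorphic_map)
  \<comment> \<open>The extension of \<open>s \<circ> f'\<close> to \<open>Z\<close> undoes the permutation \<open>f\<close> of the points of \<open>X\<close>.\<close>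
  from stone_cech_largest[OF s this] obtain k where
    k: "continuous_map Z Z k" "\<And>x. x \<in> topspace X \<Longrightarrow> k (s x) = s (f' x)"
    unfolding compactification_le_def by auto
  have "(k \<circ> g) (e x) = s x" if "x \<in> topspace X" for x
  proof -
    have "f x \<in> topspace X" "f' (f x) = x"
      using f that by (auto simp: homeomorphic_maps_def continuous_map_def)
    then show ?thesis
      using that by (simp add: g(2) k(2))
  qed
  then have "compactification_le X Z s Y e"
    unfolding compactification_le_def using continuous_map_compose[OF g(1) k(1)] by blast
  then show ?thesis
    using stone_cech_largest[OF s Y] by (simp add: compactification_equiv_def)
qed

theorem theorem6p4:
  fixes X :: "'x topology" and Y :: "'y topology" and \<beta>X :: "'z topology"
    and e :: "'x \<Rightarrow> 'y" and s :: "'x \<Rightarrow> 'z"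
  assumes "completely_regular_space X" and "Hausdorff_space X"
    and "compactification X Y e"
    and "stone_cech X \<beta>X s"
  shows "(maximal_extension (regular_open_algebra Y) (powerset_algebra X) (preimage_map X e)
            \<longleftrightarrow> comp_isomorphic X Y e X \<beta>X s)
       \<and> (comp_isomorphic X Y e X \<beta>X s \<longleftrightarrow> compactification_equiv X Y e \<beta>X s)"
proof -
  have "compactification X \<beta>X s"
    using assms(4) by (simp add: stone_cech_def)
  then have "comp_isomorphic X Y e X \<beta>X s \<longleftrightarrow> compactification_equiv X Y e \<beta>X s"
    using compactification_equiv_imp_isomorphic[OF assms(3)]
      isomorphic_stone_cech_imp_equiv[OF assms(3,4)] by blast
  moreover have "maximal_extension (regular_open_algebra Y) (powerset_algebra X) (preimage_map X e)
      \<longleftrightarrow> compactification_equiv X Y e \<beta>X s"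
    using maximal_extension_iff_stone_cech_le[OF assms(3,4)] stone_cech_largest[OF assms(4,3)]
    by (simp add: compactification_equiv_def)
  ultimately show ?thesis
    by blast
qed

end
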